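(* Let $K$ be an infinite field and let $n,r$ be positive integers. Then: (i) for every $\underline{i}\in I(n,r)$, the centralizer algebra $\widetilde{S}(\underline{i})=\xi_{\underline{i},\underline{i}}\widetilde{S}(n,r)\xi_{\underline{i},\underline{i}}$ is a Noetherian ring; (ii) the affine Schur algebra $\widetilde{S}(n,r)$ is a Noetherian ring.
   Context: Fix an infinite field $K$ and positive integers $n,r$. $\Sigma_r$ is the symmetric group on $r$ letters and $\widehat{\Sigma}_r=\Sigma_r\ltimes\mathbb{Z}^r$ is the extended affine Weyl group of type $A_{r-1}$. $I(\mathbb{Z},r)$ denotes the set of $r$-tuples $\underline{i}=(i_1,\dots,i_r)$ of integers, and $I(n,r)$ the subset of tuples with entries in $\{1,\dots,n\}$. $\widehat{\Sigma}_r$ acts on the right on $I(\mathbb{Z},r)$: $\Sigma_r$ acts by place permutation and $\varepsilon\in\mathbb{Z}^r$ acts by the shift $\underline{i}\varepsilon=\underline{i}+n\varepsilon$. It acts diagonally on $I(\mathbb{Z},r)\times I(\mathbb{Z},r)$; write $\sim$ for lying in the same $\widehat{\Sigma}_r$-orbit. To each pair $(\underline{i},\underline{j})$ associate a symbol $\xi_{\underline{i},\underline{j}}$, where $\xi_{\underline{i},\underline{j}}=\xi_{\underline{k},\underline{l}}$ if and only if $(\underline{i},\underline{j})\sim(\underline{k},\underline{l})$. The affine Schur algebra $\widetilde{S}(n,r)$ is the $K$-algebra with basis the set of these symbols and multiplication $\xi_{\underline{i},\underline{j}}\,\xi_{\underline{k},\underline{l}}=\sum_{(\underline{p},\underline{q})}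 Z(\underline{i},\underline{j},\underline{k},\underline{l},\underline{p},\underline{q})\,\xi_{\underline{p},\underline{q}}$, the sum over representatives of $\widehat{\Sigma}_r$-orbits on $I(\mathbb{Z},r)\times I(\mathbb{Z},r)$, where $Z(\underline{i},\underline{j},\underline{k},\underline{l},\underline{p},\underline{q})=\#\{\underline{s}\in I(\mathbb{Z},r)\mid (\underline{i},\underline{j})\sim(\underline{p},\underline{s}),\ (\underline{s},\underline{q})\sim(\underline{k},\underline{l})\}$. Each $\xi_{\underline{i},\underline{i}}$ is an idempotent. *)

theory Defs
  imports "HOL-Algebra.Ideal" "HOL-Combinatorics.Permutations"
begin

section \<open>Tuples and the extended affine Weyl group\<close>

type_synonym tuple = "nat \<Rightarrow> int"

definition tuples :: "nat \<Rightarrow> tuple set"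
  where "tuples r = {1..r} \<rightarrow>\<^sub>E UNIV"

definition tuples_upto :: "nat \<Rightarrow> nat \<Rightarrow> tuple set"
  where "tuples_upto n r = {1..r} \<rightarrow>\<^sub>E {1..int n}"

text \<open>The semidirect product of the symmetric group and \<open>\<int>\<^sup>r\<close>; the pair \<open>(\<sigma>, \<epsilon>)\<close> stands for the
  product \<open>\<sigma>\<epsilon>\<close>, and \<open>\<epsilon>\<tau> = \<tau>(\<epsilon> \<circ> \<tau>)\<close>.\<close>

definition ext_affine_weyl :: "nat \<Rightarrow> ((nat \<Rightarrow> nat) \<times> tuple) monoid"
  where "ext_affine_weyl r =
    \<lparr>carrier = {\<sigma>. \<sigma> permutes {1..r}} \<times> tuples r,
     monoid.mult = (\<lambda>(\<sigma>, \<epsilon>) (\<tau>, \<delta>). (\<sigma> \<circ> \<tau>, \<lambda>t\<in>{1..r}. \<epsilon> (\<tau> t) + \<delta> t)),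
     one = (id, \<lambda>t\<in>{1..r}. 0)\<rparr>"

definition act :: "nat \<Rightarrow> nat \<Rightarrow> tuple \<Rightarrow> (nat \<Rightarrow> nat) \<times> tuple \<Rightarrow> tuple"
  where "act n r i w = (case w of (\<sigma>, \<epsilon>) \<Rightarrow> \<lambda>t\<in>{1..r}. i (\<sigma> t) + int n * \<epsilon> t)"

definition orbit_rel :: "nat \<Rightarrow> nat \<Rightarrow> ((tuple \<times> tuple) \<times> (tuple \<times> tuple)) set"
  where "orbit_rel n r = {((i, j), (k, l)). i \<in> tuples r \<and> j \<in> tuples r \<and>
    (\<exists>w\<in>carrier (ext_affine_weyl r). k = act n r i w \<and> l = act n r j w)}"

lemma ext_affine_weyl_group: "group (ext_affine_weyl r)"
proof (rule groupI)
  fix x y z assume x: "x \<in> carrier (ext_affine_weyl r)" and y: "y \<in> carrier (ext_affine_weyl r)"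
    and z: "z \<in> carrier (ext_affine_weyl r)"
  show "x \<otimes>\<^bsub>ext_affine_weyl r\<^esub> y \<otimes>\<^bsub>ext_affine_weyl r\<^esub> z
      = x \<otimes>\<^bsub>ext_affine_weyl r\<^esub> (y \<otimes>\<^bsub>ext_affine_weyl r\<^esub> z)"
  proof -
    obtain \<sigma> \<epsilon> \<tau> \<delta> \<upsilon> \<eta> where *: "x = (\<sigma>, \<epsilon>)" "y = (\<tau>, \<delta>)" "z = (\<upsilon>, \<eta>)" by (metis prod.exhaust)
    then have "\<upsilon> permutes {1..r}" using z by (simp add: ext_affine_weyl_def)
    from permutes_in_image[OF this] show ?thesis
      by (simp add: * ext_affine_weyl_def fun_eq_iff algebra_simps)
  qed
next
  fix x assume x: "x \<in> carrier (ext_affine_weyl r)"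
  obtain \<sigma> \<epsilon> where x': "x = (\<sigma>, \<epsilon>)" by force
  have s: "\<sigma> permutes {1..r}" using x x' by (simp add: ext_affine_weyl_def)
  let ?\<tau> = "inv_into UNIV \<sigma>"
  let ?y = "(?\<tau>, \<lambda>t\<in>{1..r}. - \<epsilon> (?\<tau> t))"
  have "?y \<in> carrier (ext_affine_weyl r)"
    using permutes_inv[OF s] by (auto simp: ext_affine_weyl_def tuples_def)
  moreover have "?y \<otimes>\<^bsub>ext_affine_weyl r\<^esub> x = \<one>\<^bsub>ext_affine_weyl r\<^esub>"
    using permutes_in_image[OF s] permutes_inv_o(2)[OF s] permutes_inverses(2)[OF s]
    by (simp add: x' ext_affine_weyl_def fun_eq_iff)
  ultimately show "\<exists>y\<in>carrier (ext_affine_weyl r). y \<otimes>\<^bsub>ext_affine_weyl r\<^esub> x = \<one>\<^bsub>ext_affine_weyl r\<^esub>"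
    by blast
next
  fix x assume x: "x \<in> carrier (ext_affine_weyl r)"
  obtain \<sigma> \<epsilon> where x': "x = (\<sigma>, \<epsilon>)" by force
  then have "\<sigma> permutes {1..r}" using x by (simp add: ext_affine_weyl_def)
  from permutes_in_image[OF this] show "\<one>\<^bsub>ext_affine_weyl r\<^esub> \<otimes>\<^bsub>ext_affine_weyl r\<^esub> x = x"
    using x by (auto simp: x' ext_affine_weyl_def tuples_def fun_eq_iff PiE_def extensional_def)
qed (auto simp: ext_affine_weyl_def tuples_def permutes_compose permutes_id)

lemma act_closed: "act n r i w \<in> tuples r"
  by (auto simp: act_def tuples_def split: prod.splits)

lemma act_one: "i \<in> tuples r \<Longrightarrow> act n r i \<one>\<^bsub>ext_affine_weyl r\<^esub> = i"
  by (auto simp: act_def tuples_def ext_affine_weyl_def fun_eq_iff PiE_def extensional_def)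

lemma act_mult:
  assumes "v \<in> carrier (ext_affine_weyl r)" "w \<in> carrier (ext_affine_weyl r)"
  shows "act n r i (v \<otimes>\<^bsub>ext_affine_weyl r\<^esub> w) = act n r (act n r i v) w"
proof -
  obtain \<sigma> \<epsilon> \<tau> \<delta> where vw: "v = (\<sigma>, \<epsilon>)" "w = (\<tau>, \<delta>)" by force
  then have "\<tau> permutes {1..r}" using assms by (simp add: ext_affine_weyl_def)
  from permutes_in_image[OF this] show ?thesis
    by (auto simp: vw act_def ext_affine_weyl_def fun_eq_iff algebra_simps)
qed

lemma equiv_orbit_rel: "equiv (tuples r \<times> tuples r) (orbit_rel n r)"
proof (rule equivI)
  interpret group "ext_affine_weyl r" by (rule ext_affine_weyl_group)
  show "orbit_rel n r \<subseteq> (tuples r \<times> tuples r) \<times> (tuples r \<times> tuples r)"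
    by (auto simp: orbit_rel_def act_closed)
  show "refl_on (tuples r \<times> tuples r) (orbit_rel n r)"
    by (auto simp: refl_on_def orbit_rel_def act_closed intro!: bexI[of _ "\<one>\<^bsub>ext_affine_weyl r\<^esub>"] act_one[symmetric])
  show "sym (orbit_rel n r)"
  proof (rule symI)
    fix x y assume "(x, y) \<in> orbit_rel n r"
    then obtain i j w where *: "x = (i, j)" "i \<in> tuples r" "j \<in> tuples r"
      "w \<in> carrier (ext_affine_weyl r)" "y = (act n r i w, act n r j w)"
      by (auto simp: orbit_rel_def)
    let ?u = "inv\<^bsub>ext_affine_weyl r\<^esub> w"
    have "act n r (act n r k w) ?u = k" if "k \<in> tuples r" for k
      using * that by (simp add: act_mult[symmetric] act_one)
    with * show "(y, x) \<in> orbit_rel n r"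
      by (auto simp: orbit_rel_def act_closed intro!: bexI[of _ ?u])
  qed
  show "trans (orbit_rel n r)"
  proof (rule transI)
    fix x y z assume "(x, y) \<in> orbit_rel n r" "(y, z) \<in> orbit_rel n r"
    then obtain i j v w where *: "x = (i, j)" "i \<in> tuples r" "j \<in> tuples r"
      "v \<in> carrier (ext_affine_weyl r)" "w \<in> carrier (ext_affine_weyl r)"
      "z = (act n r (act n r i v) w, act n r (act n r j v) w)"
      by (auto simp: orbit_rel_def)
    then show "(x, z) \<in> orbit_rel n r"
      by (auto simp: orbit_rel_def act_mult[symmetric]
          intro!: bexI[of _ "v \<otimes>\<^bsub>ext_affine_weyl r\<^esub> w"])
  qed
qed


section \<open>The affine Schur algebra\<close>

definition orbits :: "nat \<Rightarrow> nat \<Rightarrow> (tuple \<times> tuple) set set"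
  where "orbits n r = (tuples r \<times> tuples r) // orbit_rel n r"

definition orbit_of :: "nat \<Rightarrow> nat \<Rightarrow> tuple \<Rightarrow> tuple \<Rightarrow> (tuple \<times> tuple) set"
  where "orbit_of n r i j = orbit_rel n r `` {(i, j)}"

definition structure_const :: "nat \<Rightarrow> nat \<Rightarrow> tuple \<times> tuple \<Rightarrow> tuple \<times> tuple \<Rightarrow> tuple \<times> tuple \<Rightarrow> nat"
  where "structure_const n r ij kl pq = (case (ij, kl, pq) of ((i, j), (k, l), (p, q)) \<Rightarrow>
    card {s \<in> tuples r. ((i, j), (p, s)) \<in> orbit_rel n r \<and> ((s, q), (k, l)) \<in> orbit_rel n r})"

definition representative :: "(tuple \<times> tuple) set \<Rightarrow> tuple \<times> tuple"
  where "representative C = (SOME x. x \<in> C)"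

text \<open>An element of the algebra is the family of its coefficients in the basis of symbols, indexed by
  orbits. The identity is the sum of the pairwise distinct idempotents \<open>\<xi> i i\<close>, and the product is
  the bilinear extension of the one given by the structure constants.\<close>

type_synonym 'k schur_elt = "(tuple \<times> tuple) set \<Rightarrow> 'k"

definition supp :: "('a \<Rightarrow> 'k::zero) \<Rightarrow> 'a set"
  where "supp a = {C. a C \<noteq> 0}"

definition affine_schur :: "nat \<Rightarrow> nat \<Rightarrow> ('k::field) schur_elt ring"
  where "affine_schur n r =
    \<lparr>carrier = {a. finite (supp a) \<and> supp a \<subseteq> orbits n r},
     monoid.mult = (\<lambda>a b C. if C \<in> orbits n r
       then \<Sum>A\<in>supp a. \<Sum>B\<in>supp b.
         a A * b B * of_nat (structure_const n r (representative A) (representative B) (representative C))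
       else 0),
     one = (\<lambda>C. if \<exists>i\<in>tuples r. C = orbit_of n r i i then 1 else 0),
     zero = (\<lambda>C. 0),
     add = (\<lambda>a b C. a C + b C)\<rparr>"

definition \<xi> :: "nat \<Rightarrow> nat \<Rightarrow> tuple \<Rightarrow> tuple \<Rightarrow> ('k::field) schur_elt"
  where "\<xi> n r i j = (\<lambda>C. if C = orbit_of n r i j then 1 else 0)"

lemma orbit_of_in_orbits: "i \<in> tuples r \<Longrightarrow> j \<in> tuples r \<Longrightarrow> orbit_of n r i j \<in> orbits n r"
  by (auto simp: orbit_of_def orbits_def intro: quotientI)

lemma \<xi>_eq_iff:
  assumes "i \<in> tuples r" "j \<in> tuples r" "k \<in> tuples r" "l \<in> tuples r"
  shows "(\<xi> n r i j :: 'k::field schur_elt) = \<xi> n r k l \<longleftrightarrow> ((i, j), (k, l)) \<in> orbit_rel n r"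
proof -
  have "(\<xi> n r i j :: 'k schur_elt) = \<xi> n r k l \<longleftrightarrow> orbit_of n r i j = orbit_of n r k l"
    unfolding \<xi>_def fun_eq_iff by (metis one_neq_zero)
  then show ?thesis
    using assms eq_equiv_class_iff[OF equiv_orbit_rel] by (simp add: orbit_of_def)
qed

lemma finite_structure_const_set:
  "finite {s \<in> tuples r. ((i, j), (p, s)) \<in> orbit_rel n r \<and> ((s, q), (k, l)) \<in> orbit_rel n r}"
proof (rule finite_subset)
  let ?f = "\<lambda>\<sigma>. \<lambda>t\<in>{1..r}. j (\<sigma> t) + p t - i (\<sigma> t)"
  show "finite (?f ` {\<sigma>. \<sigma> permutes {1..r}})" by (simp add: finite_permutations)
  show "{s \<in> tuples r. ((i, j), (p, s)) \<in> orbit_rel n r \<and> ((s, q), (k, l)) \<in> orbit_rel n r}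
      \<subseteq> ?f ` {\<sigma>. \<sigma> permutes {1..r}}"
  proof
    fix s assume "s \<in> {s \<in> tuples r. ((i, j), (p, s)) \<in> orbit_rel n r \<and> ((s, q), (k, l)) \<in> orbit_rel n r}"
    then obtain \<sigma> \<epsilon> where "\<sigma> permutes {1..r}" "p = act n r i (\<sigma>, \<epsilon>)" "s = act n r j (\<sigma>, \<epsilon>)"
      by (auto simp: orbit_rel_def ext_affine_weyl_def)
    then show "s \<in> ?f ` {\<sigma>. \<sigma> permutes {1..r}}"
      by (intro image_eqI[of _ _ \<sigma>]) (auto simp: act_def fun_eq_iff)
  qed
qed

lemma structure_const_cong_left:
  assumes "(ij, ij') \<in> orbit_rel n r" "(kl, kl') \<in> orbit_rel n r"
  shows "structure_const n r ij kl pq = structure_const n r ij' kl' pq"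
proof -
  have "(ij, x) \<in> orbit_rel n r \<longleftrightarrow> (ij', x) \<in> orbit_rel n r"
       "(x, kl) \<in> orbit_rel n r \<longleftrightarrow> (x, kl') \<in> orbit_rel n r" for x
    using assms equiv_orbit_rel[of r n] by (meson equivE symE transE)+
  then show ?thesis by (auto simp: structure_const_def split: prod.splits)
qed

lemma structure_const_cong_right:
  assumes "(pq, pq') \<in> orbit_rel n r"
  shows "structure_const n r ij kl pq = structure_const n r ij kl pq'"
proof -
  interpret group "ext_affine_weyl r" by (rule ext_affine_weyl_group)
  have le: "bij_betw (\<lambda>s. act n r s w)
      {s \<in> tuples r. (ij, (p, s)) \<in> orbit_rel n r \<and> ((s, q), kl) \<in> orbit_rel n r}
      {s \<in> tuples r. (ij, (act n r p w, s)) \<in> orbit_rel n r \<and> ((s, act n r q w), kl) \<in> orbit_rel n r}"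
    if w: "w \<in> carrier (ext_affine_weyl r)" and pq: "p \<in> tuples r" "q \<in> tuples r" for p q w
  proof (rule bij_betw_byWitness[where f' = "\<lambda>s. act n r s (inv\<^bsub>ext_affine_weyl r\<^esub> w)"])
    have 1: "((a, b), (act n r a v, act n r b v)) \<in> orbit_rel n r"
      if "a \<in> tuples r" "b \<in> tuples r" "v \<in> carrier (ext_affine_weyl r)" for a b v
      using that by (auto simp: orbit_rel_def)
    have inv: "act n r (act n r a w) (inv\<^bsub>ext_affine_weyl r\<^esub> w) = a"
       "act n r (act n r a (inv\<^bsub>ext_affine_weyl r\<^esub> w)) w = a" if "a \<in> tuples r" for a
      using w that by (simp_all add: act_mult[symmetric] act_one)
    have tr: "(x, z) \<in> orbit_rel n r" if "(x, y) \<in> orbit_rel n r" "(y, z) \<in> orbit_rel n r" for x y z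
      using that equiv_orbit_rel[of r n] by (meson equivE transE)
    have sy: "(y, x) \<in> orbit_rel n r" if "(x, y) \<in> orbit_rel n r" for x y
      using that equiv_orbit_rel[of r n] by (meson equivE symE)
    let ?A = "{s \<in> tuples r. (ij, (p, s)) \<in> orbit_rel n r \<and> ((s, q), kl) \<in> orbit_rel n r}"
    let ?B = "{s \<in> tuples r. (ij, (act n r p w, s)) \<in> orbit_rel n r \<and> ((s, act n r q w), kl) \<in> orbit_rel n r}"
    show "\<forall>a\<in>?A. act n r (act n r a w) (inv\<^bsub>ext_affine_weyl r\<^esub> w) = a"
      "\<forall>a\<in>?B. act n r (act n r a (inv\<^bsub>ext_affine_weyl r\<^esub> w)) w = a"
      using inv by auto
    show "(\<lambda>s. act n r s w) ` ?A \<subseteq> ?B"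
      using pq w by (auto simp: act_closed intro: tr[OF _ 1] tr[OF sy[OF 1]])
    have w': "inv\<^bsub>ext_affine_weyl r\<^esub> w \<in> carrier (ext_affine_weyl r)" using w by simp
    show "(\<lambda>s. act n r s (inv\<^bsub>ext_affine_weyl r\<^esub> w)) ` ?B \<subseteq> ?A"
    proof (intro subsetI, elim imageE, simp only:)
      fix s assume s: "s \<in> ?B"
      let ?u = "inv\<^bsub>ext_affine_weyl r\<^esub> w"
      have "((act n r p w, s), (p, act n r s ?u)) \<in> orbit_rel n r"
        using 1[of "act n r p w" s ?u] s w' pq by (simp add: act_closed inv)
      moreover have "((s, act n r q w), (act n r s ?u, q)) \<in> orbit_rel n r"
        using 1[of s "act n r q w" ?u] s w' pq by (simp add: act_closed inv)
      ultimately show "act n r s ?u \<in> ?A" using s by (auto simp: act_closed intro: tr sy)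
    qed
  qed
  obtain p q w where "pq = (p, q)" "p \<in> tuples r" "q \<in> tuples r" "w \<in> carrier (ext_affine_weyl r)"
    "pq' = (act n r p w, act n r q w)" using assms by (auto simp: orbit_rel_def)
  with bij_betw_same_card[OF le[of w p q]] show ?thesis by (auto simp: structure_const_def split: prod.splits)
qed

lemma representative_orbit_of:
  assumes "i \<in> tuples r" "j \<in> tuples r"
  shows "((i, j), representative (orbit_of n r i j)) \<in> orbit_rel n r"
proof -
  have "(i, j) \<in> orbit_of n r i j"
    using assms equiv_class_self[OF equiv_orbit_rel] by (simp add: orbit_of_def)
  then have "representative (orbit_of n r i j) \<in> orbit_of n r i j"
    unfolding representative_def by (rule someI)
  then show ?thesis by (simp add: orbit_of_def)
qed

text \<open>The defining multiplication rule of the algebra, independently of the chosen representatives.\<close>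

lemma \<xi>_mult:
  assumes "i \<in> tuples r" "j \<in> tuples r" "k \<in> tuples r" "l \<in> tuples r" "p \<in> tuples r" "q \<in> tuples r"
  shows "(\<xi> n r i j \<otimes>\<^bsub>affine_schur n r\<^esub> \<xi> n r k l) (orbit_of n r p q)
    = (of_nat (structure_const n r (i, j) (k, l) (p, q)) :: 'k::field)"
proof -
  have supp: "supp (\<xi> n r a b :: 'k schur_elt) = {orbit_of n r a b}" for a b
    by (auto simp: supp_def \<xi>_def)
  show ?thesis
    using structure_const_cong_left[OF representative_orbit_of representative_orbit_of, of i r j k l n]
      structure_const_cong_right[OF representative_orbit_of, of p r q n] assms
    by (simp add: affine_schur_def supp orbit_of_in_orbits) (simp add: \<xi>_def)
qed


section \<open>Noetherian rings and centralizer algebras\<close>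

text \<open>The library's \<open>ideal\<close> is two-sided, and its Noetherian rings are defined by means of two-sided
  ideals. For noncommutative rings the condition has to be imposed on left and on right ideals.\<close>

definition left_ideal :: "'a set \<Rightarrow> ('a, 'm) ring_scheme \<Rightarrow> bool"
  where "left_ideal I R \<longleftrightarrow> additive_subgroup I R \<and> (\<forall>a\<in>I. \<forall>x\<in>carrier R. x \<otimes>\<^bsub>R\<^esub> a \<in> I)"

definition right_ideal :: "'a set \<Rightarrow> ('a, 'm) ring_scheme \<Rightarrow> bool"
  where "right_ideal I R \<longleftrightarrow> additive_subgroup I R \<and> (\<forall>a\<in>I. \<forall>x\<in>carrier R. a \<otimes>\<^bsub>R\<^esub> x \<in> I)"

definition left_noetherian :: "('a, 'm) ring_scheme \<Rightarrow> bool"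
  where "left_noetherian R \<longleftrightarrow> ring R \<and> (\<forall>I. left_ideal I R \<longrightarrow>
    (\<exists>A\<subseteq>carrier R. finite A \<and> I = \<Inter>{J. left_ideal J R \<and> A \<subseteq> J}))"

definition right_noetherian :: "('a, 'm) ring_scheme \<Rightarrow> bool"
  where "right_noetherian R \<longleftrightarrow> ring R \<and> (\<forall>I. right_ideal I R \<longrightarrow>
    (\<exists>A\<subseteq>carrier R. finite A \<and> I = \<Inter>{J. right_ideal J R \<and> A \<subseteq> J}))"

definition noetherian :: "('a, 'm) ring_scheme \<Rightarrow> bool"
  where "noetherian R \<longleftrightarrow> left_noetherian R \<and> right_noetherian R"

text \<open>The ring \<open>eRe\<close> for an idempotent \<open>e\<close>, with identity \<open>e\<close>.\<close>

definition centralizer_algebra :: "('a, 'm) ring_scheme \<Rightarrow> 'a \<Rightarrow> ('a, 'm) ring_scheme"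
  where "centralizer_algebra R e =
    R\<lparr>carrier := {e \<otimes>\<^bsub>R\<^esub> x \<otimes>\<^bsub>R\<^esub> e | x. x \<in> carrier R}, one := e\<rparr>"

end

theory Submission
  imports Defs Complex_Main "HOL-Library.Function_Algebras"
begin

text \<open>The affine Schur algebra is a finitely generated module over a commutative Noetherian ring that
  acts centrally, and so is each \<open>\<xi> S \<xi>\<close>; this forces the Noetherian condition on both sides.

  In detail, let \<open>P = K[t\<^sub>1\<^sup>\<plusminus>, \<dots>, t\<^sub>r\<^sup>\<plusminus>]\<close>, where \<open>t\<^sub>j\<close> shifts the \<open>j\<close>-th entry of a tuple by \<open>n\<close>. An element of the
  algebra is a matrix \<open>F (p, q)\<close>, indexed by tuples, that is constant on the orbits of the extended affine
  Weyl group, and the product is the matrix product (\<open>mat_mult\<close>). Such a matrix is determined by its rows with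
  index \<open>p\<close> in \<open>tuples_upto n r\<close>, and these rows are finitely supported. So the algebra embeds into the
  free \<open>P\<close>-module of finitely supported functions on \<open>tuples_upto n r \<times> tuples r\<close>, where \<open>P\<close> acts on the column
  index. A symmetric Laurent polynomial acts there as multiplication by a central element of the
  algebra (\<open>elem_sym_central\<close>). Left ideals and right ideals are thus submodules for the subring \<open>A\<close> of \<open>P\<close>
  generated over \<open>K\<close> by the elementary symmetric polynomials in the \<open>t\<^sub>j\<close> and in their inverses. Since \<open>A\<close>
  is a finitely generated commutative algebra and every \<open>t\<^sub>j\<^sup>\<plusminus>\<close> is integral over \<open>A\<close>, being a root of
  \<open>\<Prod>\<^sub>i (X - t\<^sub>i\<^sup>\<plusminus>)\<close>, the free module is a Noetherian \<open>A\<close>-module (\<open>noetherian_row_functions\<close>), and ideals are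
  finitely generated already as \<open>A\<close>-modules (\<open>noetherian_of_central_operators\<close>). The corner rings follow
  along, since \<open>A\<close> acts on them through the elements \<open>\<xi> z \<xi>\<close> (\<open>noetherian_centralizer_algebra\<close>).

  The ring \<open>A\<close> enters only through the operators by which its generators act. Accordingly Hilbert's basis
  theorem is proved for modules over commuting additive operators (\<open>hilbert_basis_operators\<close>): starting
  from a finite-dimensional space of functions, the generators of \<open>A\<close> are adjoined one at a time, and the
  integrality relation (\<open>elem_sym_relation\<close>) shows that the result contains all finitely supported
  functions (\<open>indicator_in_submodule\<close>).\<close>

section \<open>Noetherian modules over commuting additive operators\<close>

text \<open>The modules here carry no ring: a module is a subgroup of an ambient abelian group that is
  stable under a set \<open>\<Omega>\<close> of operators. Scalars and polynomial generators are treated alike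
  in this way, and no polynomial ring has to be built.\<close>

definition op_submodule :: "('m::ab_group_add \<Rightarrow> 'm) set \<Rightarrow> 'm set \<Rightarrow> bool"
  where "op_submodule \<Omega> U \<longleftrightarrow>
    0 \<in> U \<and> (\<forall>x\<in>U. \<forall>y\<in>U. x - y \<in> U) \<and> (\<forall>f\<in>\<Omega>. \<forall>x\<in>U. f x \<in> U)"

definition noetherian_module :: "('m::ab_group_add \<Rightarrow> 'm) set \<Rightarrow> 'm set \<Rightarrow> bool"
  where "noetherian_module \<Omega> M \<longleftrightarrow>
    (\<forall>U\<subseteq>M. op_submodule \<Omega> U \<longrightarrow> (\<exists>A\<subseteq>U. finite A \<and> op_submodule \<Omega> hull A = U))"

lemma op_submoduleD:
  assumes "op_submodule \<Omega> U"
  shows "0 \<in> U" "x \<in> U \<Longrightarrow> y \<in> U \<Longrightarrow> x - y \<in> U" "f \<in> \<Omega> \<Longrightarrow> x \<in> U \<Longrightarrow> f x \<in> U"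
    "x \<in> U \<Longrightarrow> - x \<in> U" "x \<in> U \<Longrightarrow> y \<in> U \<Longrightarrow> x + y \<in> U"
proof -
  show "0 \<in> U" "x \<in> U \<Longrightarrow> y \<in> U \<Longrightarrow> x - y \<in> U" "f \<in> \<Omega> \<Longrightarrow> x \<in> U \<Longrightarrow> f x \<in> U"
    using assms by (auto simp: op_submodule_def)
  show minus: "- x \<in> U" if "x \<in> U" for x
    using assms that unfolding op_submodule_def by (metis diff_0)
  show "x + y \<in> U" if "x \<in> U" "y \<in> U"
    using assms that minus[OF that(2)] unfolding op_submodule_def by (metis diff_minus_eq_add)
qed

lemma op_submodule_sum:
  "op_submodule \<Omega> U \<Longrightarrow> (\<And>i. i \<in> I \<Longrightarrow> g i \<in> U) \<Longrightarrow> sum g I \<in> U"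
  by (induction I rule: infinite_finite_induct) (auto intro: op_submoduleD)

lemma op_submodule_hull: "op_submodule \<Omega> (op_submodule \<Omega> hull A)"
proof (rule hull_in)
  fix T :: "'a set set"
  assume "Ball T (op_submodule \<Omega>)"
  then show "op_submodule \<Omega> (\<Inter>T)"
    unfolding op_submodule_def Ball_def Inter_iff by simp
qed

lemma noetherian_moduleI:
  assumes "\<And>U. U \<subseteq> M \<Longrightarrow> op_submodule \<Omega> U \<Longrightarrow>
    \<exists>A\<subseteq>U. finite A \<and> U \<subseteq> op_submodule \<Omega> hull A"
  shows "noetherian_module \<Omega> M"
  unfolding noetherian_module_def
proof (intro allI impI)
  fix U assume UM: "U \<subseteq> M" and U: "op_submodule \<Omega> U"
  obtain A where A: "A \<subseteq> U" "finite A" "U \<subseteq> op_submodule \<Omega> hull A"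
    using assms[OF UM U] by meson
  have "op_submodule \<Omega> hull A \<subseteq> U" using A(1) U by (rule hull_minimal)
  with A show "\<exists>A\<subseteq>U. finite A \<and> op_submodule \<Omega> hull A = U"
    by (intro exI[of _ A]) simp
qed

lemma noetherian_module_subset:
  "noetherian_module \<Omega> M \<Longrightarrow> M' \<subseteq> M \<Longrightarrow> noetherian_module \<Omega> M'"
  unfolding noetherian_module_def by (metis subset_trans)

text \<open>The polynomials in \<open>T\<close> of degree less than \<open>k\<close> with coefficients in \<open>N\<close>, or rather their values: a
  representation \<open>x\<^sub>0 + T x\<^sub>1 + \<dots>\<close> need not be unique.\<close>

primrec bounded_degree :: "'m::ab_group_add set \<Rightarrow> ('m \<Rightarrow> 'm) \<Rightarrow> nat \<Rightarrow> 'm set" where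
  "bounded_degree N T 0 = {0}"
| "bounded_degree N T (Suc k) = {y + (T ^^ k) x | y x. y \<in> bounded_degree N T k \<and> x \<in> N}"

lemma bounded_degree_SucI:
  "y \<in> bounded_degree N T k \<Longrightarrow> x \<in> N \<Longrightarrow> y + (T ^^ k) x \<in> bounded_degree N T (Suc k)"
  by auto

lemma additive_funpow:
  fixes T :: "'m::ab_group_add \<Rightarrow> 'm"
  shows "additive T \<Longrightarrow> additive (T ^^ k)"
  by (induction k) (auto simp: additive_def)

lemma commute_funpow: "(\<And>x. f (T x) = T (f x)) \<Longrightarrow> f ((T ^^ k) x) = (T ^^ k) (f x)"
  by (induction k) auto

lemma op_submodule_bounded_degree:
  assumes N: "op_submodule \<Omega> N" and add: "\<And>f. f \<in> insert T \<Omega> \<Longrightarrow> additive f"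
    and comm: "\<And>f x. f \<in> \<Omega> \<Longrightarrow> f (T x) = T (f x)"
  shows "op_submodule \<Omega> (bounded_degree N T k)"
proof (induction k)
  case 0
  then show ?case using add by (auto simp: op_submodule_def additive.zero)
next
  case (Suc k)
  interpret Tk: additive "T ^^ k" using add by (simp add: additive_funpow)
  show ?case
    unfolding op_submodule_def
  proof (intro conjI ballI)
    have "0 = 0 + (T ^^ k) 0" by (simp add: Tk.zero)
    then show "0 \<in> bounded_degree N T (Suc k)"
      using bounded_degree_SucI[OF op_submoduleD(1)[OF Suc] op_submoduleD(1)[OF N]] by metis
  next
    fix a b assume "a \<in> bounded_degree N T (Suc k)" "b \<in> bounded_degree N T (Suc k)"
    then obtain y x y' x' where *: "a = y + (T ^^ k) x" "b = y' + (T ^^ k) x'" 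
      "y \<in> bounded_degree N T k" "y' \<in> bounded_degree N T k" "x \<in> N" "x' \<in> N" by auto
    have "a - b = (y - y') + (T ^^ k) (x - x')" by (simp add: * Tk.diff)
    then show "a - b \<in> bounded_degree N T (Suc k)"
      using * bounded_degree_SucI[OF op_submoduleD(2)[OF Suc] op_submoduleD(2)[OF N]] by metis
  next
    fix f a assume f: "f \<in> \<Omega>" and "a \<in> bounded_degree N T (Suc k)"
    then obtain y x where *: "a = y + (T ^^ k) x" "y \<in> bounded_degree N T k" "x \<in> N" by auto
    have "f a = f y + (T ^^ k) (f x)"
      using add[of f] f comm by (simp add: * additive.add commute_funpow)
    then show "f a \<in> bounded_degree N T (Suc k)"
      using * bounded_degree_SucI[OF op_submoduleD(3)[OF Suc f] op_submoduleD(3)[OF N f]] by metis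
  qed
qed

lemma bounded_degree_mono:
  assumes "additive T" "0 \<in> N" "k \<le> l"
  shows "bounded_degree N T k \<subseteq> bounded_degree N T l"
proof -
  interpret additive "T ^^ m" for m using assms(1) by (rule additive_funpow)
  have "bounded_degree N T m \<subseteq> bounded_degree N T (Suc m)" for m
  proof
    fix y assume "y \<in> bounded_degree N T m"
    moreover have "y = y + (T ^^ m) 0" by (simp add: zero)
    ultimately show "y \<in> bounded_degree N T (Suc m)"
      using bounded_degree_SucI[OF _ assms(2)] by metis
  qed
  then show ?thesis using assms(3) by (rule lift_Suc_mono_le)
qed

lemma bounded_degree_shift:
  assumes T: "additive T" and "0 \<in> N" and "y \<in> bounded_degree N T k"
  shows "T y \<in> bounded_degree N T (Suc k)"
  using assms(3)
proof (induction k arbitrary: y)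
  case 0
  then show ?case using T assms(2) by (auto simp: additive.zero)
next
  case (Suc k)
  then obtain y' x where *: "y = y' + (T ^^ k) x" "y' \<in> bounded_degree N T k" "x \<in> N" by auto
  have "T y = T y' + (T ^^ Suc k) x" by (simp add: * additive.add[OF T])
  then show ?case using Suc.IH[OF *(2)] *(3) by fastforce
qed

lemma bounded_degree_shift_funpow:
  assumes T: "additive T" and "0 \<in> N" and "y \<in> bounded_degree N T k"
  shows "(T ^^ m) y \<in> bounded_degree N T (m + k)"
proof (induction m)
  case (Suc m)
  from bounded_degree_shift[OF assms(1,2) this] show ?case by simp
qed (simp add: assms)

text \<open>Since \<open>T\<close> commutes with \<open>\<Omega>\<close>, the values of polynomials in \<open>T\<close> with coefficients in \<open>N\<close> are already
  stable under all operators.\<close>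

lemma hull_subset_bounded_degree:
  assumes N: "op_submodule \<Omega> N" and add: "\<And>f. f \<in> insert T \<Omega> \<Longrightarrow> additive f"
    and comm: "\<And>f x. f \<in> \<Omega> \<Longrightarrow> f (T x) = T (f x)"
  shows "op_submodule (insert T \<Omega>) hull N \<subseteq> (\<Union>k. bounded_degree N T k)"
proof (rule hull_minimal)
  have sub: "op_submodule \<Omega> (bounded_degree N T k)" for k
    using op_submodule_bounded_degree[OF assms] by blast
  have T: "additive T" using add by simp
  note mono = bounded_degree_mono[OF T op_submoduleD(1)[OF N]]
  have "x \<in> bounded_degree N T (Suc 0)" if "x \<in> N" for x using that by auto
  then show "N \<subseteq> (\<Union>k. bounded_degree N T k)" by blast
  show "op_submodule (insert T \<Omega>) (\<Union>k. bounded_degree N T k)"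
    unfolding op_submodule_def
  proof (intro conjI ballI)
    show "0 \<in> (\<Union>k. bounded_degree N T k)" using op_submoduleD(1)[OF sub] by blast
  next
    fix x y assume "x \<in> (\<Union>k. bounded_degree N T k)" "y \<in> (\<Union>k. bounded_degree N T k)"
    then obtain k l where "x \<in> bounded_degree N T k" "y \<in> bounded_degree N T l" by blast
    then have "x \<in> bounded_degree N T (max k l)" "y \<in> bounded_degree N T (max k l)"
      using mono[of k "max k l"] mono[of l "max k l"] by auto
    then show "x - y \<in> (\<Union>k. bounded_degree N T k)" using op_submoduleD(2)[OF sub] by blast
  next
    fix f x assume "f \<in> insert T \<Omega>" "x \<in> (\<Union>k. bounded_degree N T k)"
    then show "f x \<in> (\<Union>k. bounded_degree N T k)"
      using op_submoduleD(3)[OF sub] bounded_degree_shift[OF T op_submoduleD(1)[OF N]] by blast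
  qed
qed

text \<open>Hilbert's basis theorem for modules. The proof is the classical one by leading coefficients; that
  the representation as a polynomial in \<open>T\<close> is not unique does no harm, because only the set of
  coefficients that can occur at \<open>T\<^sup>k\<close> in an element of the submodule matters.\<close>

lemma hilbert_basis_step:
  assumes noeth: "noetherian_module \<Omega> N" and N: "op_submodule \<Omega> N"
    and add: "\<And>f. f \<in> insert T \<Omega> \<Longrightarrow> additive f"
    and comm: "\<And>f x. f \<in> \<Omega> \<Longrightarrow> f (T x) = T (f x)"
  shows "noetherian_module (insert T \<Omega>) (op_submodule (insert T \<Omega>) hull N)"
proof (rule noetherian_moduleI)
  fix U assume U_sub: "U \<subseteq> op_submodule (insert T \<Omega>) hull N" and U: "op_submodule (insert T \<Omega>) U"
  let ?F = "bounded_degree N T"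
  let ?G = "\<lambda>W. op_submodule (insert T \<Omega>) hull W"
  have F: "op_submodule \<Omega> (?F k)" for k
    using op_submodule_bounded_degree[OF N add comm] by blast
  have T: "additive T" using add by simp
  note shift = bounded_degree_shift_funpow[OF T op_submoduleD(1)[OF N]]
  have addk: "additive (T ^^ k)" for k by (rule additive_funpow[OF T])
  \<comment> \<open>The coefficients that can occur at \<open>T\<^sup>k\<close> in elements of \<open>W\<close> of degree at most \<open>k\<close>.\<close>
  define L where "L = (\<lambda>W k. {x \<in> N. \<exists>y\<in>?F k. y + (T ^^ k) x \<in> W})"
  have L_sub: "op_submodule \<Omega> (L W k)" if W: "op_submodule (insert T \<Omega>) W" for W k
    unfolding op_submodule_def
  proof (intro conjI ballI)
    show "0 \<in> L W k"
      using op_submoduleD(1)[OF N] op_submoduleD(1)[OF F[of k]] op_submoduleD(1)[OF W]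
      by (auto simp: L_def additive.zero[OF addk] intro!: bexI[of _ 0])
  next
    fix a b assume "a \<in> L W k" "b \<in> L W k"
    then obtain y z where *: "a \<in> N" "b \<in> N" "y \<in> ?F k" "z \<in> ?F k"
      "y + (T ^^ k) a \<in> W" "z + (T ^^ k) b \<in> W" by (auto simp: L_def)
    have "(y - z) + (T ^^ k) (a - b) = (y + (T ^^ k) a) - (z + (T ^^ k) b)"
      by (simp add: additive.diff[OF addk])
    then have "(y - z) + (T ^^ k) (a - b) \<in> W" using op_submoduleD(2)[OF W *(5,6)] by metis
    then show "a - b \<in> L W k"
      using * op_submoduleD(2)[OF N] op_submoduleD(2)[OF F] unfolding L_def by blast
  next
    fix f a assume f: "f \<in> \<Omega>" and "a \<in> L W k"
    then obtain y where *: "a \<in> N" "y \<in> ?F k" "y + (T ^^ k) a \<in> W" by (auto simp: L_def)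
    have "f (y + (T ^^ k) a) = f y + (T ^^ k) (f a)"
      using f add[of f] comm by (simp add: additive.add commute_funpow)
    then have "f y + (T ^^ k) (f a) \<in> W" using op_submoduleD(3)[OF W _ *(3), of f] f by simp
    then show "f a \<in> L W k"
      using * f op_submoduleD(3)[OF N f] op_submoduleD(3)[OF F f] unfolding L_def by blast
  qed
  have L_mono: "L W k \<subseteq> L W l" if W: "op_submodule (insert T \<Omega>) W" and "k \<le> l" for W k l
  proof
    fix x assume "x \<in> L W k"
    then obtain y where *: "x \<in> N" "y \<in> ?F k" "y + (T ^^ k) x \<in> W" by (auto simp: L_def)
    have "(T ^^ m) (y + (T ^^ k) x) \<in> W" for m
      using * op_submoduleD(3)[OF W] by (induction m) auto
    from this[of "l - k"] have "(T ^^ (l - k)) y + (T ^^ l) x \<in> W"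
      using \<open>k \<le> l\<close> funpow_add[of "l - k" k T] by (simp add: additive.add[OF addk])
    then show "x \<in> L W l" using shift[OF *(2), of "l - k"] * \<open>k \<le> l\<close> by (auto simp: L_def)
  qed
  have L_fg: "\<exists>A\<subseteq>V. finite A \<and> op_submodule \<Omega> hull A = V" if "V \<subseteq> N" "op_submodule \<Omega> V" for V
    using noeth that by (auto simp: noetherian_module_def)
  \<comment> \<open>The union of the increasing coefficient submodules is finitely generated, hence reached in
    some degree \<open>d\<close>.\<close>
  have Un: "op_submodule \<Omega> (\<Union>k. L U k)"
    unfolding op_submodule_def
  proof (intro conjI ballI)
    show "0 \<in> (\<Union>k. L U k)" using op_submoduleD(1)[OF L_sub[OF U]] by blast
  next
    fix x y assume "x \<in> (\<Union>k. L U k)" "y \<in> (\<Union>k. L U k)"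
    then obtain k l where "x \<in> L U k" "y \<in> L U l" by blast
    then have "x \<in> L U (max k l)" "y \<in> L U (max k l)"
      using L_mono[OF U, of k "max k l"] L_mono[OF U, of l "max k l"] by auto
    then show "x - y \<in> (\<Union>k. L U k)" using op_submoduleD(2)[OF L_sub[OF U]] by blast
  next
    fix f x assume "f \<in> \<Omega>" "x \<in> (\<Union>k. L U k)"
    then show "f x \<in> (\<Union>k. L U k)" using op_submoduleD(3)[OF L_sub[OF U]] by blast
  qed
  have "(\<Union>k. L U k) \<subseteq> N" by (auto simp: L_def)
  from L_fg[OF this Un] obtain A where A: "A \<subseteq> (\<Union>k. L U k)" "finite A"
    "op_submodule \<Omega> hull A = (\<Union>k. L U k)" by blast
  have "\<exists>d. A \<subseteq> L U d" using A(2,1)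
  proof (induction A rule: finite_induct)
    case (insert x A)
    then obtain d k where "A \<subseteq> L U d" "x \<in> L U k" by auto
    then have "insert x A \<subseteq> L U (max d k)"
      using L_mono[OF U, of d "max d k"] L_mono[OF U, of k "max d k"] by auto
    then show ?case by blast
  qed simp
  then obtain d where d: "A \<subseteq> L U d" by blast
  have L_stable: "L U k \<subseteq> L U d" for k
  proof -
    have "op_submodule \<Omega> hull A \<subseteq> L U d" using d L_sub[OF U] by (rule hull_minimal)
    then show ?thesis using A(3) by blast
  qed
  have "\<forall>k. \<exists>A\<subseteq>L U k. finite A \<and> op_submodule \<Omega> hull A = L U k"
    using L_fg[OF _ L_sub[OF U]] by (auto simp: L_def)
  then obtain B where B: "\<And>k. B k \<subseteq> L U k" "\<And>k. finite (B k)"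
    "\<And>k. op_submodule \<Omega> hull (B k) = L U k" by metis
  have "\<forall>k. \<forall>x\<in>B k. \<exists>u. u \<in> U \<and> (\<exists>y\<in>?F k. u = y + (T ^^ k) x)"
    using B(1) unfolding L_def by blast
  then obtain u where u: "\<And>k x. x \<in> B k \<Longrightarrow> u k x \<in> U"
    "\<And>k x. x \<in> B k \<Longrightarrow> \<exists>y\<in>?F k. u k x = y + (T ^^ k) x" by metis
  \<comment> \<open>Finitely many elements of \<open>U\<close> suffice to realise generators of the coefficient
    submodules in all degrees up to \<open>d\<close>; multiplying by powers of \<open>T\<close> serves the higher degrees.\<close>
  define W where "W = (\<Union>k\<le>d. u k ` B k)"
  have W: "W \<subseteq> U" "finite W" using u B by (auto simp: W_def)
  have G: "op_submodule (insert T \<Omega>) (?G W)" by (rule op_submodule_hull)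
  have GU: "?G W \<subseteq> U" using W(1) U by (rule hull_minimal)
  have L_eq: "L U k \<subseteq> L (?G W) k" for k
  proof (cases "k \<le> d")
    case True
    have "B k \<subseteq> L (?G W) k"
    proof
      fix x assume x: "x \<in> B k"
      then have "u k x \<in> W" using True by (auto simp: W_def)
      then have "u k x \<in> ?G W" by (rule hull_inc)
      then show "x \<in> L (?G W) k" using u(2)[OF x] B(1)[of k] x by (auto simp: L_def)
    qed
    then have "op_submodule \<Omega> hull B k \<subseteq> L (?G W) k" using L_sub[OF G] by (rule hull_minimal)
    then show ?thesis using B(3) by simp
  next
    case False
    have "B d \<subseteq> L (?G W) d"
    proof
      fix x assume x: "x \<in> B d"
      then have "u d x \<in> W" by (auto simp: W_def)
      then have "u d x \<in> ?G W" by (rule hull_inc)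
      then show "x \<in> L (?G W) d" using u(2)[OF x] B(1)[of d] x by (auto simp: L_def)
    qed
    then have "op_submodule \<Omega> hull B d \<subseteq> L (?G W) d" using L_sub[OF G] by (rule hull_minimal)
    then show ?thesis using B(3) L_stable[of k] L_mono[OF G, of d k] False by auto
  qed
  \<comment> \<open>Subtracting an element with the same leading coefficient lowers the degree.\<close>
  have "U \<inter> ?F k \<subseteq> ?G W" for k
  proof (induction k)
    case 0
    then show ?case using op_submoduleD(1)[OF G] by auto
  next
    case (Suc k)
    show ?case
    proof
      fix v assume v: "v \<in> U \<inter> ?F (Suc k)"
      then obtain y x where *: "v = y + (T ^^ k) x" "y \<in> ?F k" "x \<in> N" by auto
      then have "x \<in> L U k" using v by (auto simp: L_def)
      then obtain z where z: "z \<in> ?F k" "z + (T ^^ k) x \<in> ?G W"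
        using L_eq[of k] by (auto simp: L_def)
      have "v - (z + (T ^^ k) x) = y - z" by (simp add: *)
      moreover have "v - (z + (T ^^ k) x) \<in> U" using v z GU op_submoduleD(2)[OF U] by blast
      ultimately have "v - (z + (T ^^ k) x) \<in> U \<inter> ?F k"
        using op_submoduleD(2)[OF F *(2) z(1)] by (metis IntI)
      then have "v - (z + (T ^^ k) x) \<in> ?G W" using Suc by blast
      from op_submoduleD(5)[OF G this z(2)] show "v \<in> ?G W" by simp
    qed
  qed
  moreover have "U \<subseteq> (\<Union>k. ?F k)"
    using U_sub hull_subset_bounded_degree[OF N add comm] by blast
  ultimately have "U \<subseteq> ?G W" by blast
  with W show "\<exists>A\<subseteq>U. finite A \<and> U \<subseteq> ?G A" by blast
qed

text \<open>By induction on \<open>Q\<close>, since the step asks of a new operator only that it is additive and commutes with those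
  adjoined before.\<close>

lemma hilbert_basis_operators:
  assumes "finite Q" and noeth: "noetherian_module \<Omega> N" and N: "op_submodule \<Omega> N"
    and add: "\<And>f. f \<in> \<Omega> \<union> Q \<Longrightarrow> additive f"
    and comm: "\<And>f g x. f \<in> \<Omega> \<union> Q \<Longrightarrow> g \<in> Q \<Longrightarrow> f (g x) = g (f x)"
  shows "noetherian_module (\<Omega> \<union> Q) (op_submodule (\<Omega> \<union> Q) hull N)"
  using assms(1) add comm
proof (induction Q rule: finite_induct)
  case empty
  then show ?case using noeth N by (simp add: hull_same)
next
  case (insert T Q)
  let ?N = "op_submodule (\<Omega> \<union> Q) hull N"
  have "noetherian_module (\<Omega> \<union> Q) ?N" using insert by auto
  then have "noetherian_module (insert T (\<Omega> \<union> Q)) (op_submodule (insert T (\<Omega> \<union> Q)) hull ?N)"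
    by (rule hilbert_basis_step) (use insert op_submodule_hull in auto)
  moreover have "N \<subseteq> ?N" by (rule hull_subset)
  then have "op_submodule (insert T (\<Omega> \<union> Q)) hull N \<subseteq> op_submodule (insert T (\<Omega> \<union> Q)) hull ?N"
    by (rule hull_mono)
  ultimately show ?case using noetherian_module_subset by fastforce
qed

section \<open>Noetherian rings from central operators\<close>

text \<open>The link between modules and noncommutative rings: if each operator is multiplication by some
  element of the ring, from the left and from the right, then left ideals and right ideals alike are
  submodules. A finite set that generates an ideal as a module generates it all the more as an
  ideal.\<close>

lemma noetherian_of_central_operators:
  fixes R (structure) and \<phi> :: "'a \<Rightarrow> 'm::ab_group_add"
  assumes "ring R"
    and noeth: "noetherian_module \<Omega> M"
    and add: "\<And>x y. x \<in> carrier R \<Longrightarrow> y \<in> carrier R \<Longrightarrow> \<phi> (x \<oplus> y) = \<phi> x + \<phi> y"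
    and inj: "inj_on \<phi> (carrier R)" and M: "\<phi> ` carrier R \<subseteq> M"
    and central: "\<And>f. f \<in> \<Omega> \<Longrightarrow>
      \<exists>z\<in>carrier R. \<forall>x\<in>carrier R. \<phi> (z \<otimes> x) = f (\<phi> x) \<and> \<phi> (x \<otimes> z) = f (\<phi> x)"
  shows "noetherian R"
proof -
  interpret ring R by fact
  have zero: "\<phi> \<zero> = 0" using add[of \<zero> \<zero>] by simp
  have minus: "\<phi> (x \<ominus> y) = \<phi> x - \<phi> y" if "x \<in> carrier R" "y \<in> carrier R" for x y
  proof -
    have "\<phi> (\<ominus> y) + \<phi> y = 0" using add[of "\<ominus> y" y] that zero by (simp add: l_neg)
    then show ?thesis using add[of x "\<ominus> y"] that
      by (simp add: minus_eq eq_neg_iff_add_eq_0[symmetric])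
  qed
  have additiveD: "I \<subseteq> carrier R" "\<zero> \<in> I" "x \<in> I \<Longrightarrow> y \<in> I \<Longrightarrow> x \<ominus> y \<in> I"
    if "additive_subgroup I R" for I x y
    using additive_subgroup.a_subset[OF that] additive_subgroup.zero_closed[OF that]
      additive_subgroup.a_closed[OF that] additive_subgroup.a_inv_closed[OF that]
    by (auto simp: minus_eq)
  \<comment> \<open>Left and right ideals are treated together, \<open>P\<close> standing for either notion.\<close>
  have key: "\<exists>A\<subseteq>carrier R. finite A \<and> I = \<Inter>{J. P J \<and> A \<subseteq> J}"
    if I: "P I" and sub: "\<And>J. P J \<Longrightarrow> additive_subgroup J R"
      and stable: "\<And>J. P J \<Longrightarrow> op_submodule \<Omega> (\<phi> ` J)" for P I
  proof -
    note I' = additiveD(1)[OF sub[OF I]]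
    have "\<phi> ` I \<subseteq> M" using I' M by blast
    from noeth[unfolded noetherian_module_def, rule_format, OF this stable[OF I]]
    obtain B where B: "B \<subseteq> \<phi> ` I" "finite B" "op_submodule \<Omega> hull B = \<phi> ` I" by meson
    then obtain A where A: "A \<subseteq> I" "finite A" "\<phi> ` A = B"
      using finite_subset_image[OF B(2,1)] by auto
    have "I \<subseteq> J" if J: "P J" "A \<subseteq> J" for J
    proof -
      have "B \<subseteq> \<phi> ` J" using A(3) J(2) by blast
      from hull_minimal[where S = "op_submodule \<Omega>", OF this stable[OF J(1)]]
      have "\<phi> ` I \<subseteq> \<phi> ` J" using B(3) by simp
      then show ?thesis
        using inj I' additiveD(1)[OF sub[OF J(1)]]
        by (metis inj_on_image_mem_iff image_subset_iff subsetI subsetD)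
    qed
    then have "I = \<Inter>{J. P J \<and> A \<subseteq> J}"
      using I A(1) by (intro equalityI Inter_greatest Inter_lower) auto
    moreover have "A \<subseteq> carrier R" using A(1) I' by (rule subset_trans)
    ultimately show ?thesis using A(2) by (intro exI[of _ A] conjI)
  qed
  have stable: "op_submodule \<Omega> (\<phi> ` J)"
    if J: "additive_subgroup J R"
      and mult: "(\<forall>a\<in>J. \<forall>x\<in>carrier R. x \<otimes> a \<in> J) \<or> (\<forall>a\<in>J. \<forall>x\<in>carrier R. a \<otimes> x \<in> J)" for J
    unfolding op_submodule_def
  proof (intro conjI ballI)
    show "0 \<in> \<phi> ` J" using additiveD(2)[OF J] zero by (metis imageI)
  next
    fix a b assume "a \<in> \<phi> ` J" "b \<in> \<phi> ` J"
    then show "a - b \<in> \<phi> ` J"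
      using additiveD[OF J] minus by (auto simp: image_iff) (metis subsetD)
  next
    fix f a assume f: "f \<in> \<Omega>" and "a \<in> \<phi> ` J"
    then obtain x where x: "x \<in> J" "a = \<phi> x" by blast
    obtain z where z: "z \<in> carrier R" "\<phi> (z \<otimes> x) = f a" "\<phi> (x \<otimes> z) = f a"
      using central[OF f] x additiveD(1)[OF J] by blast
    have "z \<otimes> x \<in> J \<or> x \<otimes> z \<in> J" using mult x z by blast
    then show "f a \<in> \<phi> ` J" using z by (metis imageI)
  qed
  show ?thesis
    unfolding noetherian_def left_noetherian_def right_noetherian_def
    using \<open>ring R\<close> key[of "\<lambda>I. left_ideal I R"] key[of "\<lambda>I. right_ideal I R"] stable
    by (simp add: left_ideal_def right_ideal_def)
qed

lemma ring_centralizer_algebra: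
  fixes R (structure)
  assumes "ring R" and e: "e \<in> carrier R" "e \<otimes> e = e"
  shows "ring (centralizer_algebra R e)"
proof -
  interpret ring R by fact
  let ?S = "centralizer_algebra R e"
  \<comment> \<open>Over an idempotent \<open>e\<close>, the corner consists of the elements on which \<open>e\<close> acts as identity
    from both sides.\<close>
  have S: "carrier ?S = {x \<in> carrier R. e \<otimes> x = x \<and> x \<otimes> e = x}"
    (is "_ = ?C")
  proof
    show "carrier ?S \<subseteq> ?C"
    proof
      fix y assume "y \<in> carrier ?S"
      then obtain x where x: "x \<in> carrier R" "y = e \<otimes> x \<otimes> e" by (auto simp: centralizer_algebra_def)
      have "e \<otimes> (e \<otimes> x \<otimes> e) = (e \<otimes> e) \<otimes> x \<otimes> e" using x e(1) by (simp only: m_assoc m_closed)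
      moreover have "(e \<otimes> x \<otimes> e) \<otimes> e = e \<otimes> x \<otimes> (e \<otimes> e)" using x e(1) by (simp only: m_assoc m_closed)
      ultimately show "y \<in> ?C" using x e by simp
    qed
    show "?C \<subseteq> carrier ?S"
      by (auto simp: centralizer_algebra_def) metis
  qed
  have ops [simp]: "x \<otimes>\<^bsub>?S\<^esub> y = x \<otimes> y" "x \<oplus>\<^bsub>?S\<^esub> y = x \<oplus> y" "\<zero>\<^bsub>?S\<^esub> = \<zero>" "\<one>\<^bsub>?S\<^esub> = e" for x y
    by (simp_all add: centralizer_algebra_def)
  show ?thesis
  proof (rule ringI)
    show "abelian_group ?S"
    proof (rule abelian_groupI)
      fix x assume "x \<in> carrier ?S"
      then show "\<exists>y\<in>carrier ?S. y \<oplus>\<^bsub>?S\<^esub> x = \<zero>\<^bsub>?S\<^esub>"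
        using e by (auto simp: S l_neg r_minus l_minus intro!: bexI[of _ "\<ominus> x"])
    qed (use e in \<open>auto simp: S r_distr l_distr a_ac\<close>)
    show "monoid ?S"
    proof (rule monoidI)
      fix x y assume "x \<in> carrier ?S" "y \<in> carrier ?S"
      then show "x \<otimes>\<^bsub>?S\<^esub> y \<in> carrier ?S"
        using e by (auto simp: S m_assoc) (simp add: m_assoc[symmetric])
    qed (use e in \<open>auto simp: S m_assoc\<close>)
  qed (auto simp: S r_distr l_distr)
qed

text \<open>If \<open>z\<close> represents an operator on \<open>R\<close>, then it is central, so that \<open>e z e\<close> represents the same operator
  on \<open>e R e\<close>. Hence the corner inherits the criterion.\<close>

lemma noetherian_centralizer_algebra:
  fixes R (structure) and \<phi> :: "'a \<Rightarrow> 'm::ab_group_add"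
  assumes "ring R" and e: "e \<in> carrier R" "e \<otimes> e = e"
    and noeth: "noetherian_module \<Omega> M"
    and add: "\<And>x y. x \<in> carrier R \<Longrightarrow> y \<in> carrier R \<Longrightarrow> \<phi> (x \<oplus> y) = \<phi> x + \<phi> y"
    and inj: "inj_on \<phi> (carrier R)" and M: "\<phi> ` carrier R \<subseteq> M"
    and central: "\<And>f. f \<in> \<Omega> \<Longrightarrow>
      \<exists>z\<in>carrier R. \<forall>x\<in>carrier R. \<phi> (z \<otimes> x) = f (\<phi> x) \<and> \<phi> (x \<otimes> z) = f (\<phi> x)"
  shows "noetherian (centralizer_algebra R e)"
proof (rule noetherian_of_central_operators[OF ring_centralizer_algebra[OF assms(1-3)] noeth])
  interpret ring R by fact
  let ?S = "centralizer_algebra R e"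
  have S: "carrier ?S \<subseteq> carrier R" using e by (auto simp: centralizer_algebra_def)
  have idem: "e \<otimes> x = x" "x \<otimes> e = x" if x: "x \<in> carrier ?S" for x
  proof -
    obtain y where y: "y \<in> carrier R" "x = e \<otimes> y \<otimes> e" using x by (auto simp: centralizer_algebra_def)
    then show "x \<otimes> e = x" using e by (simp add: m_assoc)
    have "e \<otimes> x = (e \<otimes> e) \<otimes> y \<otimes> e" using y e(1) by (simp only: m_assoc m_closed)
    then show "e \<otimes> x = x" using y e by simp
  qed
  show "\<phi> (x \<oplus>\<^bsub>?S\<^esub> y) = \<phi> x + \<phi> y" if "x \<in> carrier ?S" "y \<in> carrier ?S" for x y
    using add[OF subsetD[OF S that(1)] subsetD[OF S that(2)]]
    by (simp add: centralizer_algebra_def)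
  show "inj_on \<phi> (carrier ?S)" using inj S by (rule inj_on_subset)
  show "\<phi> ` carrier ?S \<subseteq> M" using M S by blast
  fix f assume "f \<in> \<Omega>"
  from central[OF this] obtain z where z: "z \<in> carrier R" "\<And>x. x \<in> carrier R \<Longrightarrow> \<phi> (z \<otimes> x) = f (\<phi> x)"
    "\<And>x. x \<in> carrier R \<Longrightarrow> \<phi> (x \<otimes> z) = f (\<phi> x)" by meson
  \<comment> \<open>Left and right multiplication by \<open>z\<close> have the same image under the injective \<open>\<phi>\<close>.\<close>
  have comm: "z \<otimes> x = x \<otimes> z" if "x \<in> carrier R" for x
    by (rule inj_onD[OF inj]) (use z that in simp_all)
  let ?z = "e \<otimes> z \<otimes> e"
  have "?z \<otimes> x = z \<otimes> x" "x \<otimes> ?z = x \<otimes> z" if x: "x \<in> carrier ?S" for x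
  proof -
    have xR: "x \<in> carrier R" using x S by blast
    have "?z = z \<otimes> e \<otimes> e" using comm[OF e(1)] by simp
    then have ze: "?z = z \<otimes> e" using z(1) e by (simp add: m_assoc)
    then show 1: "?z \<otimes> x = z \<otimes> x" using idem[OF x] xR z(1) e by (simp add: m_assoc)
    have "x \<otimes> (z \<otimes> e) = x \<otimes> (e \<otimes> z)" using comm[OF e(1)] by simp
    also have "\<dots> = x \<otimes> z" using idem[OF x] xR z(1) e by (simp add: m_assoc[symmetric])
    finally show "x \<otimes> ?z = x \<otimes> z" using ze by simp
  qed
  moreover have "?z \<in> carrier ?S" using z(1) by (auto simp: centralizer_algebra_def)
  moreover have "x \<otimes>\<^bsub>?S\<^esub> y = x \<otimes> y" for x y by (simp add: centralizer_algebra_def)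
  ultimately show "\<exists>z\<in>carrier ?S. \<forall>x\<in>carrier ?S.
      \<phi> (z \<otimes>\<^bsub>?S\<^esub> x) = f (\<phi> x) \<and> \<phi> (x \<otimes>\<^bsub>?S\<^esub> z) = f (\<phi> x)"
    using z(2,3) subsetD[OF S] by (intro bexI[of _ ?z] ballI conjI) simp_all
qed

section \<open>The affine Schur algebra as a ring of invariant matrices\<close>

abbreviation weyl where "weyl r \<equiv> carrier (ext_affine_weyl r)"

text \<open>An element of the algebra, given by its coefficients on orbits, is the same as a matrix indexed by
  tuples that is constant on orbits. In this form the structure constants turn into the usual matrix
  product, see \<open>mat_mult\<close> below, and associativity is the associativity of matrix multiplication.\<close>

definition mat :: "nat \<Rightarrow> nat \<Rightarrow> 'k::zero schur_elt \<Rightarrow> tuple \<times> tuple \<Rightarrow> 'k"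
  where "mat n r a = (\<lambda>(p, q). if p \<in> tuples r \<and> q \<in> tuples r then a (orbit_of n r p q) else 0)"

lemma mat_nonzeroD: "mat n r a (p, q) \<noteq> 0 \<Longrightarrow>
    p \<in> tuples r \<and> q \<in> tuples r \<and> orbit_of n r p q \<in> supp a"
  by (auto simp: mat_def supp_def split: if_splits)

lemma orbit_of_eq_iff:
  assumes "i \<in> tuples r" "j \<in> tuples r" "k \<in> tuples r" "l \<in> tuples r"
  shows "orbit_of n r i j = orbit_of n r k l \<longleftrightarrow> ((i, j), (k, l)) \<in> orbit_rel n r"
  using assms eq_equiv_class_iff[OF equiv_orbit_rel] by (simp add: orbit_of_def)

lemma orbit_rel_act:
  "i \<in> tuples r \<Longrightarrow> j \<in> tuples r \<Longrightarrow> w \<in> weyl r \<Longrightarrow> ((i, j), (act n r i w, act n r j w)) \<in> orbit_rel n r"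
  by (auto simp: orbit_rel_def)

lemma orbit_of_act:
  assumes "i \<in> tuples r" "j \<in> tuples r" "w \<in> weyl r"
  shows "orbit_of n r (act n r i w) (act n r j w) = orbit_of n r i j"
  using assms orbit_rel_act[OF assms, of n] orbit_of_eq_iff[of i r j "act n r i w" "act n r j w" n]
  by (simp add: act_closed)

lemma orbitsE:
  assumes "C \<in> orbits n r"
  obtains p q where "p \<in> tuples r" "q \<in> tuples r" "C = orbit_of n r p q"
  using assms by (auto simp: orbits_def orbit_of_def elim!: quotientE)

lemma mat_act:
  assumes "p \<in> tuples r" "q \<in> tuples r" "w \<in> weyl r"
  shows "mat n r a (act n r p w, act n r q w) = mat n r a (p, q)"
  using assms by (simp add: mat_def orbit_of_act act_closed)

text \<open>Up to the choice of a permutation, the second member of a pair in a given orbit is determined by the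
  first one, the shift \<open>\<epsilon>\<close> being recovered from the first members. So the matrices of the algebra are
  row finite and column finite, and their products are finite sums.\<close>

lemma finite_orbit_row: "finite {s \<in> tuples r. orbit_of n r p s = C}"
  and finite_orbit_col: "finite {s \<in> tuples r. orbit_of n r s p = C}" if p: "p \<in> tuples r"
proof -
  have diff: "\<exists>\<sigma>. \<sigma> permutes {1..r} \<and> s = (\<lambda>t\<in>{1..r}. j (\<sigma> t) + p t - i (\<sigma> t))"
    if "w \<in> weyl r" "p = act n r i w" "s = act n r j w" for i j s w
  proof -
    obtain \<sigma> \<epsilon> where w: "w = (\<sigma>, \<epsilon>)" by force
    then have "\<sigma> permutes {1..r}" using that by (simp add: ext_affine_weyl_def)
    then show ?thesis using that w by (auto simp: act_def fun_eq_iff)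
  qed
  have fin: "finite ((\<lambda>\<sigma>. \<lambda>t\<in>{1..r}. j (\<sigma> t) + p t - i (\<sigma> t)) ` {\<sigma>. \<sigma> permutes {1..r}})" for i j :: tuple
    by (simp add: finite_permutations)
  show "finite {s \<in> tuples r. orbit_of n r p s = C}"
  proof (cases "\<exists>s\<in>tuples r. orbit_of n r p s = C")
    case True
    then obtain u where u: "u \<in> tuples r" "orbit_of n r p u = C" by blast
    show ?thesis
    proof (rule finite_subset[OF _ fin[of u p]], clarify)
      fix s assume s: "s \<in> tuples r" "C = orbit_of n r p s"
      then have "((p, u), (p, s)) \<in> orbit_rel n r" using u p orbit_of_eq_iff[of p r u p s n] by simp
      then obtain w where "w \<in> weyl r" "p = act n r p w" "s = act n r u w"
        unfolding orbit_rel_def by auto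
      from diff[OF this] show "s \<in> (\<lambda>\<sigma>. \<lambda>t\<in>{1..r}. u (\<sigma> t) + p t - p (\<sigma> t)) ` {\<sigma>. \<sigma> permutes {1..r}}"
        by blast
    qed
  next
    case False
    then have "{s \<in> tuples r. orbit_of n r p s = C} = {}" by blast
    then show ?thesis by (simp only: finite.emptyI)
  qed
  show "finite {s \<in> tuples r. orbit_of n r s p = C}"
  proof (cases "\<exists>s\<in>tuples r. orbit_of n r s p = C")
    case True
    then obtain u where u: "u \<in> tuples r" "orbit_of n r u p = C" by blast
    show ?thesis
    proof (rule finite_subset[OF _ fin[of u p]], clarify)
      fix s assume s: "s \<in> tuples r" "C = orbit_of n r s p"
      then have "((u, p), (s, p)) \<in> orbit_rel n r" using u p orbit_of_eq_iff[of u r p s p n] by simp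
      then obtain w where "w \<in> weyl r" "p = act n r p w" "s = act n r u w"
        unfolding orbit_rel_def by auto
      from diff[OF this] show "s \<in> (\<lambda>\<sigma>. \<lambda>t\<in>{1..r}. u (\<sigma> t) + p t - p (\<sigma> t)) ` {\<sigma>. \<sigma> permutes {1..r}}"
        by blast
    qed
  next
    case False
    then have "{s \<in> tuples r. orbit_of n r s p = C} = {}" by blast
    then show ?thesis by (simp only: finite.emptyI)
  qed
qed

lemma carrierD:
  "a \<in> carrier (affine_schur n r) \<Longrightarrow> finite (supp a)"
  "a \<in> carrier (affine_schur n r) \<Longrightarrow> C \<notin> orbits n r \<Longrightarrow> a C = 0"
  by (auto simp: affine_schur_def supp_def)

lemma finite_mat_row: "finite {s. mat n r a (p, s) \<noteq> 0}"
  and finite_mat_col: "finite {s. mat n r a (s, p) \<noteq> 0}" if a: "a \<in> carrier (affine_schur n r)"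
proof -
  have "finite (\<Union>C\<in>supp a. {s \<in> tuples r. orbit_of n r p s = C})" if "p \<in> tuples r"
    by (intro finite_UN_I carrierD(1)[OF a] finite_orbit_row that)
  moreover have "{s. mat n r a (p, s) \<noteq> 0} \<subseteq> (\<Union>C\<in>supp a. {s \<in> tuples r. orbit_of n r p s = C})"
    by (auto dest!: mat_nonzeroD)
  moreover have "{s. mat n r a (p, s) \<noteq> 0} = {}" if "p \<notin> tuples r" using that by (auto simp: mat_def)
  ultimately show "finite {s. mat n r a (p, s) \<noteq> 0}"
    by (cases "p \<in> tuples r") (simp_all add: finite_subset)
  have "finite (\<Union>C\<in>supp a. {s \<in> tuples r. orbit_of n r s p = C})" if "p \<in> tuples r"
    by (intro finite_UN_I carrierD(1)[OF a] finite_orbit_col that)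
  moreover have "{s. mat n r a (s, p) \<noteq> 0} \<subseteq> (\<Union>C\<in>supp a. {s \<in> tuples r. orbit_of n r s p = C})"
    by (auto dest!: mat_nonzeroD)
  moreover have "{s. mat n r a (s, p) \<noteq> 0} = {}" if "p \<notin> tuples r" using that by (auto simp: mat_def)
  ultimately show "finite {s. mat n r a (s, p) \<noteq> 0}"
    by (cases "p \<in> tuples r") (simp_all add: finite_subset)
qed

lemma tuples_upto_subset: "tuples_upto n r \<subseteq> tuples r"
  by (auto simp: tuples_upto_def tuples_def)

lemma finite_tuples_upto: "finite (tuples_upto n r)"
  by (simp add: tuples_upto_def finite_PiE)

text \<open>Reduction of all entries modulo \<open>n\<close>, to the residues \<open>1, \<dots>, n\<close>.\<close>

lemma move_to_tuples_upto:
  assumes "n > 0" "p \<in> tuples r"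
  obtains w where "w \<in> weyl r" "act n r p w \<in> tuples_upto n r"
proof
  let ?w = "(id, \<lambda>t\<in>{1..r}. - ((p t - 1) div int n)) :: (nat \<Rightarrow> nat) \<times> tuple"
  show "?w \<in> weyl r" by (auto simp: ext_affine_weyl_def tuples_def permutes_id)
  have "p t + int n * - ((p t - 1) div int n) = (p t - 1) mod int n + 1" for t
    using mult_div_mod_eq[of "int n" "p t - 1"] by (simp add: algebra_simps)
  moreover have "(p t - 1) mod int n + 1 \<in> {1..int n}" for t
    using assms(1) by (simp add: add1_zle_eq)
  ultimately show "act n r p ?w \<in> tuples_upto n r"
    unfolding act_def tuples_upto_def by auto
qed

text \<open>Every orbit meets the finitely many rows indexed by \<open>tuples_upto n r\<close>, so membership is a
  matter of finiteness of these rows only.\<close>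

lemma carrier_affine_schurI:
  assumes n: "n > 0" and a: "\<And>C. C \<notin> orbits n r \<Longrightarrow> a C = 0"
    and fin: "\<And>p. p \<in> tuples_upto n r \<Longrightarrow> finite {q. mat n r a (p, q) \<noteq> 0}"
  shows "a \<in> carrier (affine_schur n r)"
proof -
  have "supp a \<subseteq> (\<Union>p\<in>tuples_upto n r. orbit_of n r p ` {q. mat n r a (p, q) \<noteq> 0})"
  proof
    fix C assume C: "C \<in> supp a"
    then have "C \<in> orbits n r" using a by (auto simp: supp_def)
    then obtain p q where pq: "p \<in> tuples r" "q \<in> tuples r" "C = orbit_of n r p q" by (rule orbitsE)
    obtain w where w: "w \<in> weyl r" "act n r p w \<in> tuples_upto n r" by (rule move_to_tuples_upto[OF n pq(1)])
    have "mat n r a (act n r p w, act n r q w) \<noteq> 0"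
      using pq w C mat_act[of p r q w n a] by (simp add: mat_def supp_def)
    moreover have "C = orbit_of n r (act n r p w) (act n r q w)" using pq w by (simp add: orbit_of_act)
    ultimately show "C \<in> (\<Union>p\<in>tuples_upto n r. orbit_of n r p ` {q. mat n r a (p, q) \<noteq> 0})"
      using w(2) by blast
  qed
  then have "finite (supp a)"
    using fin finite_tuples_upto by (meson finite_UN_I finite_imageI finite_subset)
  then show ?thesis using a by (auto simp: affine_schur_def supp_def)
qed

lemma schur_elt_eqI:
  assumes "\<And>C. C \<notin> orbits n r \<Longrightarrow> a C = 0" "\<And>C. C \<notin> orbits n r \<Longrightarrow> b C = 0"
    and "\<And>p q. p \<in> tuples r \<Longrightarrow> q \<in> tuples r \<Longrightarrow> mat n r a (p, q) = mat n r b (p, q)"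
  shows "a = b"
proof
  fix C
  show "a C = b C"
  proof (cases "C \<in> orbits n r")
    case True
    then obtain p q where "p \<in> tuples r" "q \<in> tuples r" "C = orbit_of n r p q" by (rule orbitsE)
    then show ?thesis using assms(3)[of p q] by (simp add: mat_def)
  qed (simp add: assms)
qed

lemma representative_in: "C \<in> orbits n r \<Longrightarrow>
    \<exists>p\<in>tuples r. \<exists>q\<in>tuples r. representative C = (p, q) \<and> C = orbit_of n r p q"
proof -
  assume "C \<in> orbits n r"
  then obtain i j where ij: "i \<in> tuples r" "j \<in> tuples r" "C = orbit_of n r i j" by (rule orbitsE)
  obtain p q where pq: "representative C = (p, q)" by force
  have rel: "((i, j), (p, q)) \<in> orbit_rel n r"
    using representative_orbit_of[OF ij(1,2), of n] ij pq by simp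
  then have "p \<in> tuples r" "q \<in> tuples r" by (auto simp: orbit_rel_def act_closed)
  then show ?thesis using rel ij pq orbit_of_eq_iff[of i r j p q n] by auto
qed

lemma structure_const_representative:
  assumes A: "A \<in> orbits n r" and B: "B \<in> orbits n r" and pq: "p \<in> tuples r" "q \<in> tuples r"
  shows "structure_const n r (representative A) (representative B) (representative (orbit_of n r p q))
    = card {s \<in> tuples r. orbit_of n r p s = A \<and> orbit_of n r s q = B}"
proof -
  obtain i j where ij: "i \<in> tuples r" "j \<in> tuples r" "representative A = (i, j)" "A = orbit_of n r i j"
    using representative_in[OF A] by blast
  obtain k l where kl: "k \<in> tuples r" "l \<in> tuples r" "representative B = (k, l)" "B = orbit_of n r k l"
    using representative_in[OF B] by blast
  have "structure_const n r (i, j) (k, l) (representative (orbit_of n r p q))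
      = structure_const n r (i, j) (k, l) (p, q)"
    using structure_const_cong_right[OF representative_orbit_of[OF pq]] by metis
  also have "\<dots> = card {s \<in> tuples r. orbit_of n r p s = A \<and> orbit_of n r s q = B}"
    unfolding structure_const_def
    using ij kl pq by (auto intro!: arg_cong[where f = card] simp: orbit_of_eq_iff[symmetric])
  finally show ?thesis by (simp only: ij(3) kl(3))
qed

text \<open>The sum runs over any finite \<open>S\<close> that contains the indices of nonzero terms, so that the support of
  a row or of a column can be chosen as convenient.\<close>

lemma mat_mult:
  fixes a b :: "'k::field schur_elt"
  assumes a: "a \<in> carrier (affine_schur n r)" and b: "b \<in> carrier (affine_schur n r)"
    and pq: "p \<in> tuples r" "q \<in> tuples r"
    and S: "finite S" "\<And>s. mat n r a (p, s) \<noteq> 0 \<Longrightarrow> mat n r b (s, q) \<noteq> 0 \<Longrightarrow> s \<in> S"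
  shows "mat n r (a \<otimes>\<^bsub>affine_schur n r\<^esub> b) (p, q) = (\<Sum>s\<in>S. mat n r a (p, s) * mat n r b (s, q))"
proof -
  have supp: "A \<in> orbits n r" if "A \<in> supp a \<or> A \<in> supp b" for A
    using that carrierD(2)[OF a] carrierD(2)[OF b] by (auto simp: supp_def)
  let ?P = "\<lambda>s A B. s \<in> tuples r \<and> orbit_of n r p s = A \<and> orbit_of n r s q = B"
  \<comment> \<open>Write each structure constant as a sum over \<open>S\<close> of truth values; then exchange the
    summations.\<close>
  have count: "of_nat (structure_const n r (representative A) (representative B)
        (representative (orbit_of n r p q))) = (\<Sum>s\<in>S. if ?P s A B then 1 else 0 :: 'k)"
    if AB: "A \<in> supp a" "B \<in> supp b" for A B
  proof -
    have "{s \<in> tuples r. orbit_of n r p s = A \<and> orbit_of n r s q = B} = {s \<in> S. ?P s A B}"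
      using AB S(2) pq by (auto simp: mat_def supp_def)
    moreover have "(\<Sum>s\<in>S. if ?P s A B then 1 else 0 :: 'k) = of_nat (card {s \<in> S. ?P s A B})"
      using sum.inter_filter[OF S(1), of "\<lambda>_. 1 :: 'k" "\<lambda>s. ?P s A B"] by simp
    ultimately show ?thesis using AB pq supp by (simp add: structure_const_representative)
  qed
  have inner: "(\<Sum>A\<in>supp a. \<Sum>B\<in>supp b. a A * b B * (if ?P s A B then 1 else 0))
      = mat n r a (p, s) * mat n r b (s, q)" for s
  proof (cases "s \<in> tuples r")
    case True
    have "(\<Sum>A\<in>supp a. \<Sum>B\<in>supp b. a A * b B * (if ?P s A B then 1 else 0))
      = (\<Sum>A\<in>supp a. \<Sum>B\<in>supp b.
          (if orbit_of n r p s = A then a A else 0) * (if orbit_of n r s q = B then b B else 0))"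
      using True by (intro sum.cong) auto
    also have "\<dots> = (\<Sum>A\<in>supp a. if orbit_of n r p s = A then a A else 0) *
        (\<Sum>B\<in>supp b. if orbit_of n r s q = B then b B else 0)"
      by (simp add: sum_product)
    also have "\<dots> = a (orbit_of n r p s) * b (orbit_of n r s q)"
      using carrierD(1)[OF a] carrierD(1)[OF b] by (simp add: sum.delta') (auto simp: supp_def)
    finally show ?thesis using True pq by (simp add: mat_def)
  qed (simp add: mat_def)
  have "mat n r (a \<otimes>\<^bsub>affine_schur n r\<^esub> b) (p, q) =
      (\<Sum>A\<in>supp a. \<Sum>B\<in>supp b. a A * b B * of_nat (structure_const n r (representative A)
        (representative B) (representative (orbit_of n r p q))))"
    using pq by (simp add: mat_def affine_schur_def orbit_of_in_orbits)
  also have "\<dots> = (\<Sum>A\<in>supp a. \<Sum>B\<in>supp b. \<Sum>s\<in>S. a A * b B * (if ?P s A B then 1 else 0))"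
    by (intro sum.cong refl) (simp only: count sum_distrib_left)
  also have "\<dots> = (\<Sum>A\<in>supp a. \<Sum>s\<in>S. \<Sum>B\<in>supp b. a A * b B * (if ?P s A B then 1 else 0))"
    by (intro sum.cong refl) (rule sum.swap)
  also have "\<dots> = (\<Sum>s\<in>S. \<Sum>A\<in>supp a. \<Sum>B\<in>supp b. a A * b B * (if ?P s A B then 1 else 0))"
    by (rule sum.swap)
  also have "\<dots> = (\<Sum>s\<in>S. mat n r a (p, s) * mat n r b (s, q))"
    by (simp only: inner)
  finally show ?thesis .
qed

lemma mult_outside: "C \<notin> orbits n r \<Longrightarrow> (a \<otimes>\<^bsub>affine_schur n r\<^esub> b) C = 0"
  by (simp add: affine_schur_def)

lemma mult_closed:
  assumes n: "n > 0" and a: "a \<in> carrier (affine_schur n r)" and b: "b \<in> carrier (affine_schur n r)"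
  shows "a \<otimes>\<^bsub>affine_schur n r\<^esub> b \<in> carrier (affine_schur n r)"
proof (rule carrier_affine_schurI[OF n])
  let ?S = "\<lambda>p. {s. mat n r a (p, s) \<noteq> 0}"
  fix p assume "p \<in> tuples_upto n r"
  then have p: "p \<in> tuples r" using tuples_upto_subset by blast
  have "{q. mat n r (a \<otimes>\<^bsub>affine_schur n r\<^esub> b) (p, q) \<noteq> 0} \<subseteq> (\<Union>s\<in>?S p. {q. mat n r b (s, q) \<noteq> 0})"
  proof
    fix q assume q: "q \<in> {q. mat n r (a \<otimes>\<^bsub>affine_schur n r\<^esub> b) (p, q) \<noteq> 0}"
    then have "q \<in> tuples r" by (auto dest: mat_nonzeroD)
    with q have "(\<Sum>s\<in>?S p. mat n r a (p, s) * mat n r b (s, q)) \<noteq> 0"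
      using mat_mult[OF a b p _ finite_mat_row[OF a], of q] by auto
    then obtain s where "s \<in> ?S p" "mat n r a (p, s) * mat n r b (s, q) \<noteq> 0"
      by (rule sum.not_neutral_contains_not_neutral)
    then show "q \<in> (\<Union>s\<in>?S p. {q. mat n r b (s, q) \<noteq> 0})" by auto
  qed
  then show "finite {q. mat n r (a \<otimes>\<^bsub>affine_schur n r\<^esub> b) (p, q) \<noteq> 0}"
    by (rule finite_subset) (auto intro: finite_mat_row a b)
qed (rule mult_outside)

text \<open>For this reason the identity and the idempotents \<open>\<xi> n r i i\<close> are diagonal matrices.\<close>

lemma orbit_of_diagonal:
  assumes "p \<in> tuples r" "q \<in> tuples r"
  shows "(\<exists>i\<in>tuples r. orbit_of n r p q = orbit_of n r i i) \<longleftrightarrow> p = q"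
proof
  assume "\<exists>i\<in>tuples r. orbit_of n r p q = orbit_of n r i i"
  then obtain i where "i \<in> tuples r" "orbit_of n r i i = orbit_of n r p q" by auto
  then have "((i, i), (p, q)) \<in> orbit_rel n r" using orbit_of_eq_iff[of i r i p q n] assms by simp
  then show "p = q" by (auto simp: orbit_rel_def)
qed (use assms in auto)

lemma mat_one:
  "mat n r \<one>\<^bsub>affine_schur n r\<^esub> (p, q) = (if p \<in> tuples r \<and> p = q then 1 else 0 :: 'k::field)"
  using orbit_of_diagonal[of p r q n] by (auto simp: mat_def affine_schur_def)

lemma one_outside: "C \<notin> orbits n r \<Longrightarrow> \<one>\<^bsub>affine_schur n r\<^esub> C = 0"
  by (auto simp: affine_schur_def orbit_of_in_orbits)

lemma mat_add: "mat n r (a \<oplus>\<^bsub>affine_schur n r\<^esub> b) (p, q) = mat n r a (p, q) + mat n r b (p, q)"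
  by (simp add: mat_def affine_schur_def)

lemma add_closed:
  assumes "a \<in> carrier (affine_schur n r)" "b \<in> carrier (affine_schur n r)"
  shows "a \<oplus>\<^bsub>affine_schur n r\<^esub> b \<in> carrier (affine_schur n r)"
proof -
  have "supp (\<lambda>C. a C + b C) \<subseteq> supp a \<union> supp b" by (auto simp: supp_def)
  then show ?thesis using assms by (auto simp: affine_schur_def intro: finite_subset)
qed

lemma ring_affine_schur:
  assumes n: "n > 0"
  shows "ring (affine_schur n r :: 'k::field schur_elt ring)"
proof (rule ringI)
  let ?R = "affine_schur n r :: 'k schur_elt ring"
  show "abelian_group ?R"
  proof (rule abelian_groupI)
    fix a assume a: "a \<in> carrier ?R"
    have "supp (\<lambda>C. - a C) = supp a" by (auto simp: supp_def)
    then have "(\<lambda>C. - a C) \<in> carrier ?R" using a by (simp add: affine_schur_def)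
    moreover have "(\<lambda>C. - a C) \<oplus>\<^bsub>?R\<^esub> a = \<zero>\<^bsub>?R\<^esub>" by (simp add: affine_schur_def)
    ultimately show "\<exists>b\<in>carrier ?R. b \<oplus>\<^bsub>?R\<^esub> a = \<zero>\<^bsub>?R\<^esub>" by blast
  qed (auto simp: add_closed, auto simp: affine_schur_def supp_def ac_simps)
  have one: "\<one>\<^bsub>?R\<^esub> \<in> carrier ?R"
    by (rule carrier_affine_schurI[OF n one_outside]) (auto simp: mat_one)
  note mult = mult_closed[OF n] and out = mult_outside and mm = mat_mult
  show "monoid ?R"
  proof (rule monoidI)
    fix a b c assume a: "a \<in> carrier ?R" and b: "b \<in> carrier ?R" and c: "c \<in> carrier ?R"
    show "(a \<otimes>\<^bsub>?R\<^esub> b) \<otimes>\<^bsub>?R\<^esub> c = a \<otimes>\<^bsub>?R\<^esub> (b \<otimes>\<^bsub>?R\<^esub> c)"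
    proof (rule schur_elt_eqI[OF out out])
      fix p q assume p: "p \<in> tuples r" and q: "q \<in> tuples r"
      \<comment> \<open>The row support of \<open>a\<close> and the column support of \<open>c\<close> serve both bracketings.\<close>
      let ?S = "{s. mat n r a (p, s) \<noteq> 0}" and ?T = "{t. mat n r c (t, q) \<noteq> 0}"
      have S: "finite ?S" and T: "finite ?T" by (rule finite_mat_row[OF a] finite_mat_col[OF c])+
      have "mat n r ((a \<otimes>\<^bsub>?R\<^esub> b) \<otimes>\<^bsub>?R\<^esub> c) (p, q) = (\<Sum>t\<in>?T. mat n r (a \<otimes>\<^bsub>?R\<^esub> b) (p, t) * mat n r c (t, q))"
        using mm[OF mult[OF a b] c p q T] by simp
      also have "\<dots> = (\<Sum>t\<in>?T. (\<Sum>s\<in>?S. mat n r a (p, s) * mat n r b (s, t)) * mat n r c (t, q))"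
        using mm[OF a b p _ S] by (intro sum.cong refl) (auto dest!: mat_nonzeroD)
      also have "\<dots> = (\<Sum>t\<in>?T. \<Sum>s\<in>?S. mat n r a (p, s) * (mat n r b (s, t) * mat n r c (t, q)))"
        by (simp add: sum_distrib_right mult.assoc)
      also have "\<dots> = (\<Sum>s\<in>?S. \<Sum>t\<in>?T. mat n r a (p, s) * (mat n r b (s, t) * mat n r c (t, q)))"
        by (rule sum.swap)
      also have "\<dots> = (\<Sum>s\<in>?S. mat n r a (p, s) * (\<Sum>t\<in>?T. mat n r b (s, t) * mat n r c (t, q)))"
        by (simp add: sum_distrib_left)
      also have "\<dots> = (\<Sum>s\<in>?S. mat n r a (p, s) * mat n r (b \<otimes>\<^bsub>?R\<^esub> c) (s, q))"
        using mm[OF b c _ q T] by (intro sum.cong refl) (auto dest!: mat_nonzeroD)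
      also have "\<dots> = mat n r (a \<otimes>\<^bsub>?R\<^esub> (b \<otimes>\<^bsub>?R\<^esub> c)) (p, q)"
        using mm[OF a mult[OF b c] p q S] by simp
      finally show "mat n r ((a \<otimes>\<^bsub>?R\<^esub> b) \<otimes>\<^bsub>?R\<^esub> c) (p, q) = mat n r (a \<otimes>\<^bsub>?R\<^esub> (b \<otimes>\<^bsub>?R\<^esub> c)) (p, q)" .
    qed
  next
    fix a assume a: "a \<in> carrier ?R"
    show "\<one>\<^bsub>?R\<^esub> \<otimes>\<^bsub>?R\<^esub> a = a"
    proof (rule schur_elt_eqI[OF out carrierD(2)[OF a]])
      fix p q assume p: "p \<in> tuples r" and q: "q \<in> tuples r"
      show "mat n r (\<one>\<^bsub>?R\<^esub> \<otimes>\<^bsub>?R\<^esub> a) (p, q) = mat n r a (p, q)"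
        by (subst mm[OF one a p q, of "{p}"]) (auto simp: mat_one p split: if_splits)
    qed
    show "a \<otimes>\<^bsub>?R\<^esub> \<one>\<^bsub>?R\<^esub> = a"
    proof (rule schur_elt_eqI[OF out carrierD(2)[OF a]])
      fix p q assume p: "p \<in> tuples r" and q: "q \<in> tuples r"
      show "mat n r (a \<otimes>\<^bsub>?R\<^esub> \<one>\<^bsub>?R\<^esub>) (p, q) = mat n r a (p, q)"
        by (subst mm[OF a one p q, of "{q}"]) (auto simp: mat_one q split: if_splits)
    qed
  qed (use one mult in auto)
  have out_add: "(a \<oplus>\<^bsub>?R\<^esub> b) C = 0" if "a C = 0" "b C = 0" for a b C
    using that by (simp add: affine_schur_def)
  fix a b c assume a: "a \<in> carrier ?R" and b: "b \<in> carrier ?R" and c: "c \<in> carrier ?R"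
  show "(a \<oplus>\<^bsub>?R\<^esub> b) \<otimes>\<^bsub>?R\<^esub> c = a \<otimes>\<^bsub>?R\<^esub> c \<oplus>\<^bsub>?R\<^esub> b \<otimes>\<^bsub>?R\<^esub> c"
  proof (rule schur_elt_eqI[OF out out_add[OF out out]])
    fix p q assume p: "p \<in> tuples r" and q: "q \<in> tuples r"
    have T: "finite {t. mat n r c (t, q) \<noteq> 0}" by (rule finite_mat_col[OF c])
    show "mat n r ((a \<oplus>\<^bsub>?R\<^esub> b) \<otimes>\<^bsub>?R\<^esub> c) (p, q) = mat n r (a \<otimes>\<^bsub>?R\<^esub> c \<oplus>\<^bsub>?R\<^esub> b \<otimes>\<^bsub>?R\<^esub> c) (p, q)"
      using mm[OF add_closed[OF a b] c p q T] mm[OF a c p q T] mm[OF b c p q T]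
      by (simp add: mat_add distrib_right sum.distrib)
  qed
  show "c \<otimes>\<^bsub>?R\<^esub> (a \<oplus>\<^bsub>?R\<^esub> b) = c \<otimes>\<^bsub>?R\<^esub> a \<oplus>\<^bsub>?R\<^esub> c \<otimes>\<^bsub>?R\<^esub> b"
  proof (rule schur_elt_eqI[OF out out_add[OF out out]])
    fix p q assume p: "p \<in> tuples r" and q: "q \<in> tuples r"
    have T: "finite {t. mat n r c (p, t) \<noteq> 0}" by (rule finite_mat_row[OF c])
    show "mat n r (c \<otimes>\<^bsub>?R\<^esub> (a \<oplus>\<^bsub>?R\<^esub> b)) (p, q) = mat n r (c \<otimes>\<^bsub>?R\<^esub> a \<oplus>\<^bsub>?R\<^esub> c \<otimes>\<^bsub>?R\<^esub> b) (p, q)"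
      using mm[OF c add_closed[OF a b] p q T] mm[OF c a p q T] mm[OF c b p q T]
      by (simp add: mat_add distrib_left sum.distrib)
  qed
qed

lemma \<xi>_diagonal_closed:
  assumes "n > 0" "i \<in> tuples r"
  shows "(\<xi> n r i i :: 'k::field schur_elt) \<in> carrier (affine_schur n r)"
proof -
  have "supp (\<xi> n r i i :: 'k schur_elt) = {orbit_of n r i i}" by (auto simp: supp_def \<xi>_def)
  then show ?thesis using assms by (simp add: affine_schur_def orbit_of_in_orbits)
qed

lemma \<xi>_diagonal_idempotent:
  assumes n: "n > 0" and i: "i \<in> tuples r"
  shows "\<xi> n r i i \<otimes>\<^bsub>affine_schur n r\<^esub> \<xi> n r i i = (\<xi> n r i i :: 'k::field schur_elt)"
proof (rule schur_elt_eqI[OF mult_outside])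
  note e = \<xi>_diagonal_closed[OF n i, where 'k = 'k]
  show "(\<xi> n r i i :: 'k schur_elt) C = 0" if "C \<notin> orbits n r" for C
    using carrierD(2)[OF e that] .
  fix p q assume p: "p \<in> tuples r" and q: "q \<in> tuples r"
  have diag: "s = t" if "mat n r (\<xi> n r i i :: 'k schur_elt) (s, t) \<noteq> 0" for s t
  proof -
    have "s \<in> tuples r" "t \<in> tuples r" "orbit_of n r s t = orbit_of n r i i"
      using that i by (auto simp: mat_def \<xi>_def split: if_splits)
    then show ?thesis using orbit_of_diagonal[of s r t n] i by blast
  qed
  have "mat n r (\<xi> n r i i \<otimes>\<^bsub>affine_schur n r\<^esub> \<xi> n r i i :: 'k schur_elt) (p, q) =
      (\<Sum>s\<in>{p}. mat n r (\<xi> n r i i :: 'k schur_elt) (p, s) * mat n r (\<xi> n r i i) (s, q))"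
    by (rule mat_mult[OF e e p q]) (auto dest: diag)
  also have "\<dots> = mat n r (\<xi> n r i i) (p, q)"
  proof (cases "p = q")
    case True
    then show ?thesis using p by (simp add: mat_def \<xi>_def)
  next
    case False
    then have "mat n r (\<xi> n r i i :: 'k schur_elt) (p, q) = 0" using diag by blast
    then show ?thesis by simp
  qed
  finally show "mat n r (\<xi> n r i i \<otimes>\<^bsub>affine_schur n r\<^esub> \<xi> n r i i :: 'k schur_elt) (p, q) = mat n r (\<xi> n r i i) (p, q)" .
qed

section \<open>Elementary symmetric operators\<close>

text \<open>With \<open>c = n\<close>, this is the action of the monomial \<open>\<Prod>\<^bsub>j\<in>J\<^esub> t\<^sub>j\<close> of the Laurent polynomial ring, where
  \<open>t\<^sub>j\<close> adds \<open>n\<close> to the entry in place \<open>j\<close>; with \<open>c = - n\<close> it is that of the inverse monomial.\<close>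

definition translate :: "int \<Rightarrow> nat set \<Rightarrow> tuple \<Rightarrow> tuple"
  where "translate c J q = (\<lambda>t. if t \<in> J then q t + c else q t)"

text \<open>The action of the elementary symmetric polynomial \<open>e\<^sub>k\<close> in \<open>t\<^sub>1, \<dots>, t\<^sub>r\<close> (for \<open>c = n\<close>) or in their
  inverses (for \<open>c = - n\<close>) on the column index. The sign of \<open>c\<close> is reversed because translating a function
  forwards means evaluating it at the point translated backwards.\<close>

definition elem_sym :: "nat \<Rightarrow> int \<Rightarrow> nat \<Rightarrow> (tuple \<times> tuple \<Rightarrow> 'k::comm_ring_1) \<Rightarrow> tuple \<times> tuple \<Rightarrow> 'k"
  where "elem_sym r c k G = (\<lambda>(p, q). \<Sum>J | J \<subseteq> {1..r} \<and> card J = k. G (p, translate (- c) J q))"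

definition scale :: "'k::comm_ring_1 \<Rightarrow> ('a \<Rightarrow> 'k) \<Rightarrow> 'a \<Rightarrow> 'k"
  where "scale c G = (\<lambda>x. c * G x)"

definition indicator_at :: "'a \<Rightarrow> 'a \<Rightarrow> 'k::zero_neq_one"
  where "indicator_at x = (\<lambda>y. if y = x then 1 else 0)"

lemma finite_subsets_card: "finite {J. J \<subseteq> {1..r::nat} \<and> card J = k}"
  by (rule finite_subset[of _ "Pow {1..r}"]) auto

lemma translate_translate_neg [simp]: "translate c J (translate (- c) J q) = q"
  "translate (- c) J (translate c J q) = q"
  by (auto simp: translate_def fun_eq_iff)

lemma translate_commute: "translate c J (translate d L q) = translate d L (translate c J q)"
  by (auto simp: translate_def fun_eq_iff)

lemma translate_in_tuples: "J \<subseteq> {1..r} \<Longrightarrow> q \<in> tuples r \<Longrightarrow> translate c J q \<in> tuples r"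
  by (auto simp: translate_def tuples_def PiE_def extensional_def)

lemma additive_scale: "additive (scale c)"
  by (rule additive.intro) (simp add: scale_def fun_eq_iff distrib_left)

lemma additive_elem_sym: "additive (elem_sym r c k)"
  by (rule additive.intro) (auto simp: elem_sym_def fun_eq_iff sum.distrib)

lemma elem_sym_scale: "elem_sym r c k (scale d G) = scale d (elem_sym r c k G)"
  by (auto simp: elem_sym_def scale_def fun_eq_iff sum_distrib_left)

lemma elem_sym_commute: "elem_sym r c k (elem_sym r d l G) = elem_sym r d l (elem_sym r c k G)"
proof
  fix x :: "tuple \<times> tuple"
  obtain p q where x: "x = (p, q)" by force
  show "elem_sym r c k (elem_sym r d l G) x = elem_sym r d l (elem_sym r c k G) x"
    unfolding x elem_sym_def prod.case by (subst sum.swap) (simp only: translate_commute)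
qed

lemma sum_Pow_insert:
  fixes f :: "'a set \<Rightarrow> 'b::comm_monoid_add"
  assumes "finite A" "t \<notin> A"
  shows "(\<Sum>J\<in>Pow (insert t A). f J) = (\<Sum>J\<in>Pow A. f J + f (insert t J))"
proof -
  have inj: "inj_on (insert t) (Pow A)" using assms(2) by (auto simp: inj_on_def)
  have "(\<Sum>J\<in>Pow (insert t A). f J) = (\<Sum>J\<in>Pow A. f J) + (\<Sum>J\<in>insert t ` Pow A. f J)"
    unfolding Pow_insert using assms by (intro sum.union_disjoint) auto
  then show ?thesis using inj by (simp add: sum.reindex sum.distrib)
qed

lemma sum_fun_apply: "(\<Sum>i\<in>A. f i :: _ \<Rightarrow> _::comm_monoid_add) x = (\<Sum>i\<in>A. f i x)"
  by (induction A rule: infinite_finite_induct) auto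

text \<open>This is the integrality of the variables over the symmetric polynomials. Let \<open>x\<close> be the variable that
  translates place \<open>t\<close> by \<open>c\<close>, and let \<open>e\<^sub>k\<close> be the elementary symmetric polynomials in all such variables.
  As a root of the polynomial with coefficients \<open>(-1)\<^sup>k e\<^sub>k\<close>, it satisfies
  \<open>x\<^sup>r = - (\<Sum>k=1..r. (-1)\<^sup>k e\<^sub>k x\<^bsup>r-k\<^esup>)\<close>. The version here is multiplied by \<open>x\<^bsup>-r\<^esup>\<close> and applied to an
  indicator function. Expanding \<open>e\<^sub>k\<close> over subsets \<open>J\<close>, the terms of \<open>J\<close> and of \<open>J \<union> {t}\<close> cancel
  when \<open>t\<close> is not in \<open>J\<close>.\<close>

lemma elem_sym_relation:
  fixes p q :: tuple
  assumes t: "t \<in> {1..r}"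
  shows "(indicator_at (p, q) :: _ \<Rightarrow> 'k::comm_ring_1) =
    - (\<Sum>k=1..r. scale ((- 1) ^ k) (elem_sym r c k (indicator_at (p, q(t := q t - c * int k)))))"
proof -
  define f :: "tuple \<times> tuple \<Rightarrow> nat set \<Rightarrow> 'k" where "f = (\<lambda>(p', y) J. (- 1) ^ card J *
    indicator_at (p, q(t := q t - c * int (card J))) (p', translate (- c) J y))"
  have split: "(\<Sum>J\<in>Pow {1..r}. f x J) = (\<Sum>k=0..r.
      scale ((- 1) ^ k) (elem_sym r c k (indicator_at (p, q(t := q t - c * int k)))) x)" for x
  proof -
    have card: "card J \<in> {0..r}" if "J \<subseteq> {1..r}" for J
      using card_mono[OF _ that] by simp
    have "(\<Sum>J\<in>Pow {1..r}. f x J) = (\<Sum>k=0..r. \<Sum>J\<in>{J \<in> Pow {1..r}. card J = k}. f x J)"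
      by (rule sum.group[symmetric]) (use card in auto)
    also have "\<dots> = (\<Sum>k=0..r. scale ((- 1) ^ k)
        (elem_sym r c k (indicator_at (p, q(t := q t - c * int k)))) x)"
      by (intro sum.cong refl)
        (auto simp: f_def scale_def elem_sym_def sum_distrib_left split: prod.split intro!: sum.cong)
    finally show ?thesis .
  qed
  have "(\<Sum>J\<in>Pow {1..r}. f x J) = 0" for x
  proof -
    obtain p' y where x: "x = (p', y)" by force
    have A: "{1..r} = insert t ({1..r} - {t})" using t by blast
    have "f x J + f x (insert t J) = 0" if J: "J \<subseteq> {1..r} - {t}" for J
    proof -
      have fin: "finite J" "t \<notin> J" using J by (auto intro: finite_subset)
      have "translate (- c) (insert t J) y = q(t := q t - c * int (card (insert t J))) \<longleftrightarrow>
          translate (- c) J y = q(t := q t - c * int (card J))"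
        using fin unfolding fun_eq_iff
        by (intro all_cong1) (auto simp: translate_def algebra_simps)
      then show ?thesis using fin by (simp add: f_def x indicator_at_def)
    qed
    then show ?thesis by (subst A, subst sum_Pow_insert) auto
  qed
  then have "(\<Sum>k=0..r. scale ((- 1) ^ k)
      (elem_sym r c k (indicator_at (p, q(t := q t - c * int k)))) x) = (0 :: 'k)" for x
    using split by simp
  then have "(\<Sum>k=0..r. scale ((- 1) ^ k)
      (elem_sym r c k (indicator_at (p, q(t := q t - c * int k)) :: _ \<Rightarrow> 'k))) = 0"
    by (simp add: fun_eq_iff sum_fun_apply)
  moreover have "{J. J \<subseteq> {1..r} \<and> card J = 0} = {{}}" by (auto simp: finite_subset)
  then have "elem_sym r c 0 G = (G :: _ \<Rightarrow> 'k)" for G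
    by (auto simp: elem_sym_def translate_def fun_eq_iff)
  moreover have "scale 1 G = (G :: tuple \<times> tuple \<Rightarrow> 'k)" for G by (simp add: scale_def)
  ultimately show ?thesis
    by (simp add: sum.atLeast_Suc_atMost eq_neg_iff_add_eq_0)
qed

section \<open>Noetherianity of the module of rows\<close>

text \<open>The start of the Hilbert basis argument, over the scalars alone: the submodules are the subspaces.\<close>

lemma noetherian_finite_dimensional:
  fixes B :: "('a \<Rightarrow> 'k::field) set"
  assumes "finite B"
  shows "noetherian_module (range scale) (op_submodule (range scale) hull B)"
proof (rule noetherian_moduleI)
  interpret vector_space "scale :: 'k \<Rightarrow> ('a \<Rightarrow> 'k) \<Rightarrow> _"
    by unfold_locales (auto simp: scale_def fun_eq_iff algebra_simps)
  have sub: "subspace V \<longleftrightarrow> op_submodule (range scale) V" for V :: "('a \<Rightarrow> 'k) set"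
  proof
    assume "subspace V"
    then show "op_submodule (range scale) V"
      unfolding op_submodule_def ball_simps by (simp add: subspace_0 subspace_diff subspace_scale)
  next
    assume V: "op_submodule (range scale) V"
    show "subspace V"
    proof (rule subspaceI)
      show "scale c x \<in> V" if "x \<in> V" for c x
        using rangeI that by (rule op_submoduleD(3)[OF V])
    qed (rule op_submoduleD[OF V]; assumption)+
  qed
  fix U assume U: "U \<subseteq> op_submodule (range scale) hull B" "op_submodule (range scale) U"
  have "op_submodule (range scale) hull B \<subseteq> span B"
    using span_superset subspace_span[unfolded sub] by (rule hull_minimal)
  then have "U \<subseteq> span B" using U(1) by (rule subset_trans[rotated])
  obtain A where A: "A \<subseteq> U" "independent A" "U \<subseteq> span A" by (rule maximal_independent_subset)
  have "finite A"
    using independent_span_bound[OF assms A(2)] A(1) \<open>U \<subseteq> span B\<close> by (meson subset_trans)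
  moreover have "span A \<subseteq> op_submodule (range scale) hull A"
    using hull_subset op_submodule_hull[of "range scale" A] unfolding sub[symmetric]
    by (rule span_minimal)
  ultimately show "\<exists>A\<subseteq>U. finite A \<and> U \<subseteq> op_submodule (range scale) hull A"
    using A by (intro exI[of _ A]) auto
qed

definition elem_syms :: "nat \<Rightarrow> nat \<Rightarrow> ((tuple \<times> tuple \<Rightarrow> 'k::comm_ring_1) \<Rightarrow> tuple \<times> tuple \<Rightarrow> 'k) set"
  where "elem_syms n r = (\<lambda>(c, k). elem_sym r c k) ` ({int n, - int n} \<times> {1..r})"

text \<open>A finite set of column indices whose indicator functions generate all others.\<close>

definition window :: "nat \<Rightarrow> nat \<Rightarrow> tuple set"
  where "window n r = {1..r} \<rightarrow>\<^sub>E {- int (n * r)..int (n * r)}"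

text \<open>If some entry of \<open>q\<close> exceeds \<open>n r\<close> in absolute value, then the relation above, with the sign of \<open>c\<close>
  chosen as that of the entry, expresses the indicator function at \<open>q\<close> through those of tuples in which
  this entry has moved towards zero without crossing it. So a descent on the sum of the
  absolute values of the entries ends in the window.\<close>

lemma indicator_in_submodule:
  fixes H :: "(tuple \<times> tuple \<Rightarrow> 'k::comm_ring_1) set"
  assumes n: "n > 0" and H: "op_submodule (range scale \<union> elem_syms n r) H"
    and window: "\<And>q. q \<in> window n r \<Longrightarrow> indicator_at (p, q) \<in> H"
    and q: "q \<in> tuples r"
  shows "indicator_at (p, q) \<in> H"
  using q
proof (induction "\<Sum>t=1..r. nat \<bar>q t\<bar>" arbitrary: q rule: less_induct)
  case less
  show ?case
  proof (cases "q \<in> window n r")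
    case False
    then obtain t where t: "t \<in> {1..r}" "\<bar>q t\<bar> > int (n * r)"
      using less.prems by (force simp: window_def tuples_def PiE_def Pi_def abs_le_iff)
    define c where "c = (if q t > 0 then int n else - int n)"
    have smaller: "indicator_at (p, q(t := q t - c * int k)) \<in> H" if k: "k \<in> {1..r}" for k
    proof (rule less.hyps)
      have "n * k \<le> n * r" "n * k > 0" using k n by auto
      then have "int (n * k) \<le> int (n * r)" "int (n * k) > 0" by (simp_all only: of_nat_le_iff of_nat_0_less_iff)
      moreover have "c * int k = (if q t > 0 then int (n * k) else - int (n * k))" by (simp add: c_def)
      ultimately have "\<bar>q t - c * int k\<bar> < \<bar>q t\<bar>" using t(2) by (auto split: if_splits)
      then have "(\<Sum>s\<in>{1..r} - {t}. nat \<bar>(q(t := q t - c * int k)) s\<bar>) + nat \<bar>q t - c * int k\<bar>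
          < (\<Sum>s\<in>{1..r} - {t}. nat \<bar>q s\<bar>) + nat \<bar>q t\<bar>"
        by (intro add_le_less_mono sum_mono) auto
      then show "(\<Sum>s=1..r. nat \<bar>(q(t := q t - c * int k)) s\<bar>) < (\<Sum>s=1..r. nat \<bar>q s\<bar>)"
        unfolding sum.remove[OF finite_atLeastAtMost t(1)] by simp
      show "q(t := q t - c * int k) \<in> tuples r"
        using less.prems t(1) by (auto simp: tuples_def PiE_def extensional_def)
    qed
    have "elem_sym r c k \<in> range scale \<union> elem_syms n r" if "k \<in> {1..r}" for k
      using that by (auto simp: elem_syms_def c_def)
    then have "scale ((- 1) ^ k) (elem_sym r c k (indicator_at (p, q(t := q t - c * int k)))) \<in> H"
      if "k \<in> {1..r}" for k
      using op_submoduleD(3)[OF H] smaller that by blast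
    then have "- (\<Sum>k=1..r. scale ((- 1) ^ k)
        (elem_sym r c k (indicator_at (p, q(t := q t - c * int k))))) \<in> H"
      by (intro op_submoduleD(4)[OF H] op_submodule_sum[OF H])
    then show ?thesis using elem_sym_relation[OF t(1), of p q c, where 'k = 'k] by simp
  qed (rule window)
qed

text \<open>The restrictions of invariant matrices to the rows in \<open>tuples_upto n r\<close> live here. As a module over
  Laurent polynomials acting on the column index, this is free of finite rank.\<close>

definition row_functions :: "nat \<Rightarrow> nat \<Rightarrow> (tuple \<times> tuple \<Rightarrow> 'k::zero) set"
  where "row_functions n r = {G. finite (supp G) \<and> supp G \<subseteq> tuples_upto n r \<times> tuples r}"

lemma noetherian_row_functions:
  assumes n: "n > 0"
  shows "noetherian_module (range scale \<union> elem_syms n r)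
    (row_functions n r :: (tuple \<times> tuple \<Rightarrow> 'k::field) set)"
proof -
  let ?B = "indicator_at ` (tuples_upto n r \<times> window n r) :: (tuple \<times> tuple \<Rightarrow> 'k) set"
  let ?N = "op_submodule (range scale) hull ?B"
  let ?\<Omega> = "range scale \<union> elem_syms n r :: ((tuple \<times> tuple \<Rightarrow> 'k) \<Rightarrow> _) set"
  let ?M = "op_submodule ?\<Omega> hull ?N"
  have "finite ?B" using finite_tuples_upto[of n r] by (simp add: window_def finite_PiE)
  then have "noetherian_module (range scale) ?N" by (rule noetherian_finite_dimensional)
  then have "noetherian_module ?\<Omega> ?M"
  proof (rule hilbert_basis_operators[rotated])
    show "finite (elem_syms n r :: ((tuple \<times> tuple \<Rightarrow> 'k) \<Rightarrow> _) set)" by (simp add: elem_syms_def)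
    show "op_submodule (range scale) ?N" by (rule op_submodule_hull)
    show "additive f" if "f \<in> ?\<Omega>" for f
      using that additive_scale additive_elem_sym by (auto simp: elem_syms_def)
    show "f (g x) = g (f x)" if "f \<in> ?\<Omega>" "g \<in> elem_syms n r" for f g x
      using that by (auto simp: elem_syms_def elem_sym_scale elem_sym_commute)
  qed
  moreover have "row_functions n r \<subseteq> ?M"
  proof
    fix G :: "tuple \<times> tuple \<Rightarrow> 'k" assume G: "G \<in> row_functions n r"
    have M: "op_submodule ?\<Omega> ?M" by (rule op_submodule_hull)
    have "indicator_at (p, q) \<in> ?M" if p: "p \<in> tuples_upto n r" and "q \<in> tuples r" for p q
    proof (rule indicator_in_submodule[OF n M _ \<open>q \<in> tuples r\<close>])
      fix q assume "q \<in> window n r"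
      then have "indicator_at (p, q) \<in> ?B" using p by blast
      then show "indicator_at (p, q) \<in> ?M" by (intro hull_inc)
    qed
    then have ind: "indicator_at x \<in> ?M" if "x \<in> supp G" for x
      using G that by (auto simp: row_functions_def)
    have "scale (G x) (indicator_at x) \<in> ?M" if "x \<in> supp G" for x
      using op_submoduleD(3)[OF M _ ind[OF that], of "scale (G x)"] by simp
    then have "(\<Sum>x\<in>supp G. scale (G x) (indicator_at x)) \<in> ?M"
      by (rule op_submodule_sum[OF M])
    moreover have "(\<Sum>x\<in>supp G. scale (G x) (indicator_at x)) = G"
    proof
      fix y
      have "(\<Sum>x\<in>supp G. scale (G x) (indicator_at x)) y = (\<Sum>x\<in>supp G. if y = x then G x else 0)"
        unfolding sum_fun_apply by (intro sum.cong) (auto simp: scale_def indicator_at_def)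
      also have "\<dots> = G y" using G by (auto simp: row_functions_def sum.delta' supp_def)
      finally show "(\<Sum>x\<in>supp G. scale (G x) (indicator_at x)) y = G y" .
    qed
    ultimately show "G \<in> ?M" by simp
  qed
  ultimately show ?thesis by (rule noetherian_module_subset)
qed

section \<open>The operators as central elements\<close>

definition rows :: "nat \<Rightarrow> nat \<Rightarrow> 'k::zero schur_elt \<Rightarrow> tuple \<times> tuple \<Rightarrow> 'k"
  where "rows n r a = (\<lambda>(p, q). if p \<in> tuples_upto n r then mat n r a (p, q) else 0)"

lemma rows_add: "rows n r (a \<oplus>\<^bsub>affine_schur n r\<^esub> b) = rows n r a + rows n r b"
  by (auto simp: rows_def mat_add fun_eq_iff)

lemma inj_on_rows:
  assumes n: "n > 0"
  shows "inj_on (rows n r) (carrier (affine_schur n r))"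
proof (rule inj_onI)
  fix a b assume a: "a \<in> carrier (affine_schur n r)" and b: "b \<in> carrier (affine_schur n r)"
    and eq: "rows n r a = rows n r b"
  show "a = b"
  proof (rule schur_elt_eqI[OF carrierD(2)[OF a] carrierD(2)[OF b]])
    fix p q assume p: "p \<in> tuples r" and q: "q \<in> tuples r"
    obtain w where w: "w \<in> weyl r" "act n r p w \<in> tuples_upto n r" by (rule move_to_tuples_upto[OF n p])
    have "mat n r a (act n r p w, act n r q w) = mat n r b (act n r p w, act n r q w)"
      using fun_cong[OF eq, of "(act n r p w, act n r q w)"] w by (simp add: rows_def)
    then show "mat n r a (p, q) = mat n r b (p, q)" using p q w by (simp add: mat_act)
  qed
qed

lemma rows_in_row_functions:
  assumes a: "a \<in> carrier (affine_schur n r)"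
  shows "rows n r a \<in> row_functions n r"
proof -
  have "supp (rows n r a) \<subseteq> (SIGMA p:tuples_upto n r. {q. mat n r a (p, q) \<noteq> 0})"
    by (auto simp: supp_def rows_def split: if_splits)
  moreover have "finite (SIGMA p:tuples_upto n r. {q. mat n r a (p, q) \<noteq> 0})"
    by (intro finite_SigmaI finite_tuples_upto finite_mat_row[OF a])
  moreover have "supp (rows n r a) \<subseteq> tuples_upto n r \<times> tuples r"
    by (auto simp: supp_def rows_def mat_def split: if_splits)
  ultimately show ?thesis unfolding row_functions_def by (auto intro: finite_subset)
qed

lemma scalar_central:
  fixes d :: "'k::field"
  assumes n: "n > 0"
  shows "\<exists>z\<in>carrier (affine_schur n r). \<forall>a\<in>carrier (affine_schur n r).
    rows n r (z \<otimes>\<^bsub>affine_schur n r\<^esub> a) = scale d (rows n r a) \<and>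
    rows n r (a \<otimes>\<^bsub>affine_schur n r\<^esub> z) = scale d (rows n r a)"
proof -
  let ?R = "affine_schur n r :: 'k schur_elt ring"
  define z :: "'k schur_elt" where "z = (\<lambda>C. d * \<one>\<^bsub>?R\<^esub> C)"
  have z: "mat n r z (p, q) = (if p \<in> tuples r \<and> p = q then d else 0)" for p q
    using mat_one[of n r p q, where 'k = 'k] by (auto simp: z_def mat_def split: if_splits)
  have zR: "z \<in> carrier ?R"
    by (rule carrier_affine_schurI[OF n]) (auto simp: z z_def[THEN fun_cong] one_outside)
  show ?thesis
  proof (intro bexI[OF _ zR] ballI conjI)
    fix a assume a: "a \<in> carrier ?R"
    have "mat n r (z \<otimes>\<^bsub>?R\<^esub> a) (p, q) = d * mat n r a (p, q)"
      "mat n r (a \<otimes>\<^bsub>?R\<^esub> z) (p, q) = d * mat n r a (p, q)" for p q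
    proof -
      show "mat n r (z \<otimes>\<^bsub>?R\<^esub> a) (p, q) = d * mat n r a (p, q)"
      proof (cases "p \<in> tuples r \<and> q \<in> tuples r")
        case True
        then show ?thesis
          by (subst mat_mult[OF zR a, of p q "{p}"]) (auto simp: z split: if_splits)
      qed (auto simp: mat_def)
      show "mat n r (a \<otimes>\<^bsub>?R\<^esub> z) (p, q) = d * mat n r a (p, q)"
      proof (cases "p \<in> tuples r \<and> q \<in> tuples r")
        case True
        then show ?thesis
          by (subst mat_mult[OF a zR, of p q "{q}"]) (auto simp: z split: if_splits)
      qed (auto simp: mat_def)
    qed
    then show "rows n r (z \<otimes>\<^bsub>?R\<^esub> a) = scale d (rows n r a)"
      "rows n r (a \<otimes>\<^bsub>?R\<^esub> z) = scale d (rows n r a)"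
      by (auto simp: rows_def scale_def fun_eq_iff)
  qed
qed

text \<open>A permutation of the places carries the subsets counted at one pair to those counted at an equivalent
  pair, so that the matrix of a symmetric polynomial is constant on orbits.\<close>

lemma translate_count_invariant:
  assumes "((p, q), (p', q')) \<in> orbit_rel n r"
  shows "card {J. J \<subseteq> {1..r} \<and> card J = k \<and> q = translate c J p}
    = card {J. J \<subseteq> {1..r} \<and> card J = k \<and> q' = translate c J p'}"
proof -
  let ?P = "\<lambda>(p, q). {J. J \<subseteq> {1..r} \<and> card J = k \<and> q = translate c J p}"
  have le: "card (?P y) \<le> card (?P x)" if xy: "(x, y) \<in> orbit_rel n r" for x y
  proof -
    obtain p q w where x: "x = (p, q)" and p: "p \<in> tuples r" and q: "q \<in> tuples r"
      and w: "w \<in> weyl r" and y: "y = (act n r p w, act n r q w)"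
      using xy unfolding orbit_rel_def by auto
    obtain \<sigma> \<epsilon> where w': "w = (\<sigma>, \<epsilon>)" by force
    then have \<sigma>: "\<sigma> permutes {1..r}" using w by (simp add: ext_affine_weyl_def)
    have inj: "inj \<sigma>" using \<sigma> by (rule permutes_inj)
    show ?thesis
    proof (rule card_inj_on_le)
      show "inj_on ((`) \<sigma>) (?P y)" using inj by (simp add: inj_on_def inj_image_eq_iff)
      show "finite (?P x)" unfolding x by (rule finite_subset[of _ "Pow {1..r}"]) auto
      show "(`) \<sigma> ` ?P y \<subseteq> ?P x"
      proof
        fix L assume "L \<in> (`) \<sigma> ` ?P y"
        then obtain J where L: "L = \<sigma> ` J" and J: "J \<subseteq> {1..r}" "card J = k"
          "act n r q w = translate c J (act n r p w)" unfolding y by blast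
        have "q s = translate c L p s" for s
        proof (cases "s \<in> {1..r}")
          case True
          then obtain t where t: "t \<in> {1..r}" "s = \<sigma> t" using permutes_image[OF \<sigma>] by blast
          have "\<sigma> t \<in> L \<longleftrightarrow> t \<in> J" using inj by (simp add: L inj_image_mem_iff)
          then show ?thesis using fun_cong[OF J(3), of t] t
            by (auto simp: act_def w' translate_def split: if_splits)
        next
          case False
          then have "s \<notin> L" using J(1) permutes_image[OF \<sigma>] unfolding L by blast
          then show ?thesis using False p q
            by (auto simp: translate_def tuples_def PiE_def extensional_def)
        qed
        moreover have "L \<subseteq> {1..r}" using J(1) permutes_image[OF \<sigma>] unfolding L by blast
        moreover have "card L = k"
          using J(2) inj unfolding L by (simp add: card_image inj_on_subset)
        ultimately show "L \<in> ?P x" unfolding x by auto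
      qed
    qed
  qed
  have "((p', q'), (p, q)) \<in> orbit_rel n r"
    using assms equiv_orbit_rel[of r n] by (meson equivE symE)
  from le[OF this] le[OF assms] show ?thesis by simp
qed

text \<open>Translating the row index forwards is, by invariance, translating the column index backwards. This is
  why left and right multiplication by a symmetric polynomial agree.\<close>

lemma mat_translate:
  assumes q: "q \<in> tuples r" and p: "p \<in> tuples r" and J: "J \<subseteq> {1..r}"
  shows "mat n r a (translate (int n * m) J p, q) = mat n r a (p, translate (- (int n * m)) J q)"
proof -
  let ?w = "(id, \<lambda>t\<in>{1..r}. if t \<in> J then - m else 0) :: (nat \<Rightarrow> nat) \<times> tuple"
  have w: "?w \<in> weyl r" by (auto simp: ext_affine_weyl_def tuples_def permutes_id)
  have act: "act n r s ?w = translate (- (int n * m)) J s" if "s \<in> tuples r" for s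
    using that J by (auto simp: act_def translate_def tuples_def PiE_def extensional_def fun_eq_iff)
  show ?thesis
    using mat_act[OF translate_in_tuples[OF J p] q w, of n a "int n * m"]
      act[OF translate_in_tuples[OF J p]] act[OF q] by simp
qed

text \<open>The central element is the symmetric polynomial \<open>e\<^sub>k\<close> itself, as a matrix: its entry at \<open>(p, q)\<close>
  counts the monomials of \<open>e\<^sub>k\<close> that move \<open>p\<close> to \<open>q\<close>.\<close>

lemma elem_sym_central:
  assumes n: "n > 0" and c: "c = int n * m"
  shows "\<exists>z\<in>carrier (affine_schur n r :: 'k::field schur_elt ring). \<forall>a\<in>carrier (affine_schur n r).
    rows n r (z \<otimes>\<^bsub>affine_schur n r\<^esub> a) = elem_sym r c k (rows n r a) \<and>
    rows n r (a \<otimes>\<^bsub>affine_schur n r\<^esub> z) = elem_sym r c k (rows n r a)"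
proof -
  let ?R = "affine_schur n r :: 'k schur_elt ring"
  let ?F = "{J. J \<subseteq> {1..r} \<and> card J = k}"
  have F: "finite ?F" by (rule finite_subsets_card)
  define count where "count = (\<lambda>(p, q). card {J. J \<subseteq> {1..r} \<and> card J = k \<and> q = translate c J p})"
  define z :: "'k schur_elt"
    where "z = (\<lambda>C. if C \<in> orbits n r then of_nat (count (representative C)) else 0)"
  have z: "mat n r z (p, q) = (\<Sum>J\<in>?F. if q = translate c J p then 1 else 0)"
    if p: "p \<in> tuples r" and q: "q \<in> tuples r" for p q
  proof -
    have "count (representative (orbit_of n r p q)) = count (p, q)"
      using translate_count_invariant[of p q _ _ n r k c] representative_orbit_of[OF p q, of n]
      unfolding count_def by (cases "representative (orbit_of n r p q)") auto
    then have "mat n r z (p, q) = of_nat (card {J \<in> ?F. q = translate c J p})"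
      using p q by (simp add: mat_def z_def orbit_of_in_orbits count_def conj_assoc)
    also have "\<dots> = (\<Sum>J\<in>{J \<in> ?F. q = translate c J p}. 1)" by simp
    also have "\<dots> = (\<Sum>J\<in>?F. if q = translate c J p then 1 else 0)"
      by (rule sum.inter_filter[OF F])
    finally show ?thesis .
  qed
  have z0: "\<exists>J\<in>?F. q = translate c J p" if nz: "mat n r z (p, q) \<noteq> 0" for p q
  proof (rule ccontr)
    assume "\<not> ?thesis"
    then have "(\<Sum>J\<in>?F. if q = translate c J p then 1 else 0 :: 'k) = 0" by (intro sum.neutral) auto
    then show False using nz z mat_nonzeroD[OF nz] by simp
  qed
  have zR: "z \<in> carrier ?R"
  proof (rule carrier_affine_schurI[OF n])
    fix p
    have "{q. mat n r z (p, q) \<noteq> 0} \<subseteq> (\<lambda>J. translate c J p) ` ?F" using z0 by blast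
    then show "finite {q. mat n r z (p, q) \<noteq> 0}" by (rule finite_subset) (rule finite_imageI[OF F])
  qed (simp add: z_def)
  show ?thesis
  proof (intro bexI[OF _ zR] ballI conjI)
    fix a assume a: "a \<in> carrier ?R"
    have left: "mat n r (z \<otimes>\<^bsub>?R\<^esub> a) (p, q) = (\<Sum>J\<in>?F. mat n r a (p, translate (- c) J q))"
      and right: "mat n r (a \<otimes>\<^bsub>?R\<^esub> z) (p, q) = (\<Sum>J\<in>?F. mat n r a (p, translate (- c) J q))"
      if p: "p \<in> tuples r" and q: "q \<in> tuples r" for p q
    proof -
      let ?S = "(\<lambda>J. translate c J p) ` ?F"
      have S: "finite ?S" "s \<in> ?S \<Longrightarrow> s \<in> tuples r" for s
        using F translate_in_tuples p by auto
      have "mat n r (z \<otimes>\<^bsub>?R\<^esub> a) (p, q) = (\<Sum>s\<in>?S. mat n r z (p, s) * mat n r a (s, q))"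
        by (rule mat_mult[OF zR a p q S(1)]) (use z0 in blast)
      also have "\<dots> = (\<Sum>s\<in>?S. \<Sum>J\<in>?F. if s = translate c J p then mat n r a (s, q) else 0)"
        by (intro sum.cong refl)
          (simp add: z p S(2) sum_distrib_right if_distrib[of "\<lambda>x. x * _"] cong: if_cong)
      also have "\<dots> = (\<Sum>J\<in>?F. \<Sum>s\<in>?S. if s = translate c J p then mat n r a (s, q) else 0)"
        by (rule sum.swap)
      also have "\<dots> = (\<Sum>J\<in>?F. mat n r a (translate c J p, q))"
        using S(1) by (intro sum.cong refl) (simp add: sum.delta)
      also have "\<dots> = (\<Sum>J\<in>?F. mat n r a (p, translate (- c) J q))"
        unfolding c by (intro sum.cong refl mat_translate[OF q p]) simp
      finally show "mat n r (z \<otimes>\<^bsub>?R\<^esub> a) (p, q) = (\<Sum>J\<in>?F. mat n r a (p, translate (- c) J q))" .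
      let ?T = "(\<lambda>J. translate (- c) J q) ` ?F"
      have T: "finite ?T" "s \<in> ?T \<Longrightarrow> s \<in> tuples r" for s
        using F translate_in_tuples q by auto
      have eq: "q = translate c J s \<longleftrightarrow> s = translate (- c) J q" for J s by auto
      have "mat n r (a \<otimes>\<^bsub>?R\<^esub> z) (p, q) = (\<Sum>s\<in>?T. mat n r a (p, s) * mat n r z (s, q))"
      proof (rule mat_mult[OF a zR p q T(1)])
        fix s assume "mat n r z (s, q) \<noteq> 0"
        from z0[OF this] show "s \<in> ?T" unfolding eq by blast
      qed
      also have "\<dots> = (\<Sum>s\<in>?T. \<Sum>J\<in>?F. if s = translate (- c) J q then mat n r a (p, s) else 0)"
        by (intro sum.cong refl)
          (simp add: z q T(2) sum_distrib_left if_distrib[of "\<lambda>x. _ * x"] eq cong: if_cong)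
      also have "\<dots> = (\<Sum>J\<in>?F. \<Sum>s\<in>?T. if s = translate (- c) J q then mat n r a (p, s) else 0)"
        by (rule sum.swap)
      also have "\<dots> = (\<Sum>J\<in>?F. mat n r a (p, translate (- c) J q))"
        using T(1) by (intro sum.cong refl) (simp add: sum.delta)
      finally show "mat n r (a \<otimes>\<^bsub>?R\<^esub> z) (p, q) = (\<Sum>J\<in>?F. mat n r a (p, translate (- c) J q))" .
    qed
    have rows: "rows n r b = elem_sym r c k (rows n r a)"
      if b: "\<And>p q. p \<in> tuples r \<Longrightarrow> q \<in> tuples r \<Longrightarrow>
        mat n r b (p, q) = (\<Sum>J\<in>?F. mat n r a (p, translate (- c) J q))" for b
    proof
      fix x :: "tuple \<times> tuple"
      obtain p q where x: "x = (p, q)" by force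
      show "rows n r b x = elem_sym r c k (rows n r a) x"
      proof (cases "p \<in> tuples_upto n r \<and> q \<in> tuples r")
        case True
        then show ?thesis using b[of p q] tuples_upto_subset[of n r] by (auto simp: x rows_def elem_sym_def)
      next
        case False
        have "translate (- c) J q \<notin> tuples r" if "J \<subseteq> {1..r}" "q \<notin> tuples r" for J
          using translate_in_tuples[OF that(1), of "translate (- c) J q" c] that(2) by auto
        then show ?thesis using False by (auto simp: x rows_def elem_sym_def mat_def intro!: sum.neutral)
      qed
    qed
    show "rows n r (z \<otimes>\<^bsub>?R\<^esub> a) = elem_sym r c k (rows n r a)" by (rule rows[OF left])
    show "rows n r (a \<otimes>\<^bsub>?R\<^esub> z) = elem_sym r c k (rows n r a)" by (rule rows[OF right])
  qed
qed

lemma operators_central: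
  assumes n: "n > 0" and f: "f \<in> range scale \<union> elem_syms n r"
  shows "\<exists>z\<in>carrier (affine_schur n r :: 'k::field schur_elt ring). \<forall>a\<in>carrier (affine_schur n r).
    rows n r (z \<otimes>\<^bsub>affine_schur n r\<^esub> a) = f (rows n r a) \<and>
    rows n r (a \<otimes>\<^bsub>affine_schur n r\<^esub> z) = f (rows n r a)"
proof -
  \<comment> \<open>Both signs of the shift are multiples of \<open>n\<close>, as \<open>elem_sym_central\<close> requires.\<close>
  have signs: "int n = int n * 1" "- int n = int n * - 1" by simp_all
  from f consider d where "f = scale d" | k where "f = elem_sym r (int n) k"
    | k where "f = elem_sym r (- int n) k"
    unfolding elem_syms_def by auto
  then show ?thesis
    using scalar_central[OF n] elem_sym_central[OF n signs(1)] elem_sym_central[OF n signs(2)]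
    by cases simp_all
qed

theorem theorem3p10:
  fixes n r :: nat
  assumes "infinite (UNIV :: 'k::field set)" and "n > 0" and "r > 0"
  shows "(\<forall>i\<in>tuples_upto n r.
            noetherian (centralizer_algebra (affine_schur n r :: 'k schur_elt ring) (\<xi> n r i i)))
       \<and> noetherian (affine_schur n r :: 'k schur_elt ring)"
proof -
  have n: "n > 0" by fact
  let ?R = "affine_schur n r :: 'k schur_elt ring"
  have M: "rows n r ` carrier ?R \<subseteq> row_functions n r" using rows_in_row_functions by blast
  note facts = noetherian_row_functions[OF n] rows_add inj_on_rows[OF n] M operators_central[OF n]
  have "noetherian (centralizer_algebra ?R (\<xi> n r i i))" if "i \<in> tuples_upto n r" for i
  proof -
    have "i \<in> tuples r" using that tuples_upto_subset by blast
    then show ?thesis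
      by (intro noetherian_centralizer_algebra[OF ring_affine_schur[OF n] \<xi>_diagonal_closed[OF n]
        \<xi>_diagonal_idempotent[OF n] facts])
  qed
  moreover have "noetherian ?R"
    by (rule noetherian_of_central_operators[OF ring_affine_schur[OF n] facts])
  ultimately show ?thesis by blast
qed

end
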